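(* Let $\Omega\subset\mathbb{R}^n$ be a bounded domain with smooth boundary containing the origin, let $1<q<2$ and $2<\alpha<Q$. Then there exists a constant $C>0$ (depending on $Q,q,\alpha,\Omega$ but not on $\phi$) such that for every $\phi\in C_0^\infty(\Omega)$, $$\int_\Omega\rho^{\alpha}\frac{|\Delta_\gamma\phi|^2}{|\nabla_\gamma\rho|^2}\,dz\ \ge\ \Big(\frac{Q-\alpha}{2}\Big)^2\int_\Omega\rho^{\alpha}\frac{|\nabla_\gamma\phi|^2}{\rho^2}\,dz+\frac{C(Q-\alpha)(Q+3\alpha-8)}{4}\Big(\int_\Omega|\nabla_\gamma\phi|^q\rho^{\frac{q(\alpha-2)}{2}}\,dz\Big)^{2/q}.$$
   Context: Points of $\mathbb{R}^n$ are written $z=(x,y)$ with $x\in\mathbb{R}^m$, $y\in\mathbb{R}^k$, $m,k\ge1$, $n=m+k$, and $\gamma>0$. The Baouendi–Grushin gradient is $\nabla_\gamma=(\partial_{x_1},\dots,\partial_{x_m},|x|^\gamma\partial_{y_1},\dots,|x|^\gamma\partial_{y_k})$, and the Baouendi–Grushin operator is $\Delta_\gamma=\nabla_\gamma\cdot\nabla_\gamma=\Delta_x+|x|^{2\gamma}\Delta_y$. The homogeneous dimension is $Q=m+(1+\gamma)k$. The gauge is $\rho(z)=\big(|x|^{2(1+\gamma)}+(1+\gamma)^2|y|^2\big)^{\frac{1}{2(1+\gamma)}}$; one has $|\nabla_\gamma\rho|=|x|^\gamma/\rho^\gamma$. The integral on the left-hand side is allowed to be $+\infty$. *)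

theory Defs
  imports "HOL-Analysis.Analysis"
begin

fun dd :: "'a::real_normed_vector list \<Rightarrow> ('a \<Rightarrow> real) \<Rightarrow> 'a \<Rightarrow> real" where
  "dd [] f = f"
| "dd (v # vs) f = (\<lambda>z. frechet_derivative (dd vs f) (at z) v)"

definition Cinf_on :: "'a::euclidean_space set \<Rightarrow> ('a \<Rightarrow> real) \<Rightarrow> bool" where
  "Cinf_on S f \<longleftrightarrow> (\<forall>vs. set vs \<subseteq> Basis \<longrightarrow> (\<forall>z\<in>S. dd vs f differentiable (at z)))"

definition Cinf0 :: "'a::euclidean_space set \<Rightarrow> ('a \<Rightarrow> real) \<Rightarrow> bool" where
  "Cinf0 \<Omega> f \<longleftrightarrow> Cinf_on UNIV f \<and> compact (closure {z. f z \<noteq> 0}) \<and> closure {z. f z \<noteq> 0} \<subseteq> \<Omega>"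

definition smooth_bounded_domain :: "'a::euclidean_space set \<Rightarrow> bool" where
  "smooth_bounded_domain \<Omega> \<longleftrightarrow> open \<Omega> \<and> connected \<Omega> \<and> bounded \<Omega> \<and> \<Omega> \<noteq> {} \<and>
     (\<forall>p\<in>frontier \<Omega>. \<exists>U g. open U \<and> p \<in> U \<and> Cinf_on U g \<and>
        (\<forall>z\<in>U. frechet_derivative g (at z) \<noteq> (\<lambda>v. 0)) \<and>
        \<Omega> \<inter> U = {z\<in>U. g z < 0})"

definition grad_gamma_sq :: "real \<Rightarrow> ('a::euclidean_space \<times> 'b::euclidean_space \<Rightarrow> real) \<Rightarrow> 'a \<times> 'b \<Rightarrow> real" where
  "grad_gamma_sq \<gamma> f z =
     (\<Sum>e\<in>Basis. (frechet_derivative f (at z) (e, 0))\<^sup>2)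
     + (norm (fst z) powr \<gamma>)\<^sup>2 * (\<Sum>e\<in>Basis. (frechet_derivative f (at z) (0, e))\<^sup>2)"

definition grad_gamma_norm :: "real \<Rightarrow> ('a::euclidean_space \<times> 'b::euclidean_space \<Rightarrow> real) \<Rightarrow> 'a \<times> 'b \<Rightarrow> real" where
  "grad_gamma_norm \<gamma> f z = sqrt (grad_gamma_sq \<gamma> f z)"

definition grushin_laplacian :: "real \<Rightarrow> ('a::euclidean_space \<times> 'b::euclidean_space \<Rightarrow> real) \<Rightarrow> 'a \<times> 'b \<Rightarrow> real" where
  "grushin_laplacian \<gamma> f z =
     (\<Sum>e\<in>Basis. dd [(e, 0), (e, 0)] f z)
     + norm (fst z) powr (2 * \<gamma>) * (\<Sum>e\<in>Basis. dd [(0, e), (0, e)] f z)"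

definition hom_dim :: "real \<Rightarrow> 'a::euclidean_space itself \<Rightarrow> 'b::euclidean_space itself \<Rightarrow> real" where
  "hom_dim \<gamma> _ _ = real DIM('a) + (1 + \<gamma>) * real DIM('b)"

definition gauge :: "real \<Rightarrow> 'a::euclidean_space \<times> 'b::euclidean_space \<Rightarrow> real" where
  "gauge \<gamma> z = (norm (fst z) powr (2 * (1 + \<gamma>)) + (1 + \<gamma>)\<^sup>2 * (norm (snd z))\<^sup>2) powr (1 / (2 * (1 + \<gamma>)))"

end

theory Submission
  imports Defs
begin

text \<open>Write \<open>H = (Q + \<alpha> - 4) / 2\<close>, \<open>B\<close> for the integral of \<open>\<rho>\<^sup>\<alpha>\<^sup>-\<^sup>2 |\<nabla>\<^sub>\<gamma>\<phi>|\<^sup>2\<close> and \<open>D\<close> for that of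
  \<open>\<rho>\<^sup>\<alpha>\<^sup>-\<^sup>4 |\<nabla>\<^sub>\<gamma>\<rho>|\<^sup>2 \<phi>\<^sup>2\<close>. Green's identity expresses the integral of \<open>\<rho>\<^sup>\<alpha>\<^sup>-\<^sup>2 \<phi> \<Delta>\<^sub>\<gamma>\<phi>\<close> by \<open>B\<close> and \<open>D\<close>, and
  Young's inequality with the right parameter bounds the left-hand side below by
  \<open>((Q - \<alpha>) / 2)\<^sup>2 B + (Q - \<alpha>) (Q + 3 \<alpha> - 8) / 4 (B - H\<^sup>2 D)\<close>; the last factor is positive because
  \<open>Q > \<alpha> > 2\<close>.

  Moreover \<open>B - H\<^sup>2 D\<close> is the integral of \<open>\<rho>\<^sup>\<alpha>\<^sup>-\<^sup>2 |\<nabla>\<^sub>\<gamma>\<phi> + H \<phi> \<nabla>\<^sub>\<gamma>\<rho> / \<rho>|\<^sup>2\<close>. A Hardy inequality with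
  an extra weight \<open>\<rho>\<^sup>\<delta>\<close>, \<open>\<delta> = (2 - q) / q\<close>, shows that this square controls the integral of
  \<open>\<rho>\<^sup>\<alpha>\<^sup>-\<^sup>2\<^sup>+\<^sup>\<delta> |\<nabla>\<^sub>\<gamma>\<phi>|\<^sup>2\<close> on bounded sets, and Hoelder's inequality passes from there to the
  \<open>q\<close>-th power, at the cost of the integral of \<open>1 / \<rho>\<close> over \<open>\<Omega>\<close>.\<close>

subsection \<open>Integration by parts\<close>

lemma integrable_compact_support:
  fixes h :: "'a::euclidean_space \<Rightarrow> real"
  assumes "compact S" "continuous_on UNIV h" "\<And>z. z \<notin> S \<Longrightarrow> h z = 0"
  shows "integrable lborel h"
proof -
  have "integrable lborel (\<lambda>z. indicator S z *\<^sub>R h z)"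
    using borel_integrable_compact[OF assms(1) continuous_on_subset[OF assms(2)]] by simp
  moreover have "(\<lambda>z. indicator S z *\<^sub>R h z) = h"
    using assms(3) by (auto simp: indicator_def fun_eq_iff)
  ultimately show ?thesis by simp
qed

text \<open>Translation invariance kills the integral of every difference quotient of \<open>a g\<close> along \<open>e\<close>.
  Since \<open>a\<close> is constant in that direction, no derivative of \<open>a\<close> is needed; this covers the
  factor \<open>|x|\<^sup>2\<^sup>\<gamma>\<close>, which may fail to be differentiable.\<close>
lemma integral_directional_derivative_eq_0:
  fixes g a :: "'a::euclidean_space \<Rightarrow> real"
  assumes S: "compact S" and g: "\<And>z. (g has_derivative G z) (at z)"
    and supp: "\<And>z. z \<notin> S \<Longrightarrow> g z = 0"
    and G: "continuous_on UNIV (\<lambda>z. G z e)"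
    and a: "continuous_on UNIV a" and a_const: "\<And>z t. a (z + t *\<^sub>R e) = a z"
  shows "integrable lborel (\<lambda>z. a z * G z e)" and "(\<integral>z. a z * G z e \<partial>lborel) = 0"
proof -
  define h h' where "h z = a z * g z" and "h' z = a z * G z e" for z
  have gc: "continuous_on UNIV g"
    using g by (meson continuous_at_imp_continuous_on has_derivative_continuous)
  have hc: "continuous_on UNIV h" and h'c: "continuous_on UNIV h'"
    unfolding h_def h'_def by (intro continuous_intros gc G a)+
  have h0: "h z = 0" if "z \<notin> S" for z using supp[OF that] by (simp add: h_def)
  have h'0: "h' z = 0" if "z \<notin> S" for z
  proof -
    have "open (- S)" using S by (simp add: compact_imp_closed open_Compl)
    then have "(g has_derivative (\<lambda>_. 0)) (at z)"
      by (rule has_derivative_transform_within_open[rotated 1, where f="\<lambda>_. 0"])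
         (use that supp in auto)
    then have "G z = (\<lambda>_. 0)" using g has_derivative_unique by blast
    then show ?thesis by (simp add: h'_def)
  qed
  show "integrable lborel (\<lambda>z. a z * G z e)"
    using integrable_compact_support[OF S h'c h'0] by (simp add: h'_def)
  have "bounded (h' ` S)"
    using S h'c by (meson compact_continuous_image compact_imp_bounded continuous_on_subset subset_UNIV)
  then obtain K0 where K0: "\<forall>x\<in>h' ` S. norm x \<le> K0" unfolding bounded_iff by blast
  define K where "K = max 0 K0"
  have K: "\<bar>h' z\<bar> \<le> K" for z
    using K0 h'0[of z] by (cases "z \<in> S") (force simp: K_def)+
  obtain R where R: "\<forall>z\<in>S. norm z \<le> R" using S compact_imp_bounded bounded_iff by metis
  \<comment> \<open>Every shift has length at most \<open>norm e\<close>, so both terms of the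
    difference quotient vanish outside a ball that exceeds one around \<open>S\<close> by
    \<open>norm e\<close>.\<close>
  define T where "T = cball (0::'a) (R + norm e)"
  define s where "s n z = (h (z + inverse (real (Suc n)) *\<^sub>R e) - h z) * real (Suc n)" for n z
  have line: "((\<lambda>t. g (z + t *\<^sub>R e)) has_real_derivative G (z + t *\<^sub>R e) e) (at t)" for z t
  proof -
    have "((\<lambda>t. g (z + t *\<^sub>R e)) has_derivative (\<lambda>u. G (z + t *\<^sub>R e) (u *\<^sub>R e))) (at t)"
      by (rule has_derivative_compose[OF _ g]) (auto intro!: derivative_eq_intros)
    moreover have "linear (G (z + t *\<^sub>R e))" using g has_derivative_linear by blast
    ultimately show ?thesis
      by (simp add: has_field_derivative_def linear_cmul mult_commute_abs)
  qed
  have sb: "\<bar>s n z\<bar> \<le> K * indicator T z" for n z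
  proof (cases "z \<in> T")
    case True
    \<comment> \<open>Since \<open>a\<close> is constant along the segment, the mean value theorem
      for \<open>g\<close> alone identifies \<open>s n z\<close> with a value of \<open>h'\<close>
      at an intermediate point; hence \<open>K\<close> bounds all quotients uniformly in
      \<open>n\<close>.\<close>
    have "\<exists>t>0. t < inverse (real (Suc n)) \<and>
        g (z + inverse (real (Suc n)) *\<^sub>R e) - g (z + 0 *\<^sub>R e) = (inverse (real (Suc n)) - 0) * G (z + t *\<^sub>R e) e"
      by (rule MVT2) (use line in auto)
    then obtain t where t: "g (z + inverse (real (Suc n)) *\<^sub>R e) - g z
        = inverse (real (Suc n)) * G (z + t *\<^sub>R e) e" by auto
    have "s n z = (g (z + inverse (real (Suc n)) *\<^sub>R e) - g z) * a z * real (Suc n)"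
      by (simp add: s_def h_def a_const algebra_simps)
    also have "\<dots> = h' (z + t *\<^sub>R e)"
      unfolding t h'_def a_const by simp
    finally show ?thesis using K True by simp
  next
    case False
    have n1: "norm (inverse (real (Suc n)) *\<^sub>R e) \<le> norm e"
      using mult_left_le_one_le[of "norm e" "inverse (real (Suc n))"] by (simp add: inverse_le_1_iff)
    have "z \<notin> S" using False R by (auto simp: T_def) (smt (verit) norm_ge_zero)
    moreover have "z + inverse (real (Suc n)) *\<^sub>R e \<notin> S"
    proof
      assume "z + inverse (real (Suc n)) *\<^sub>R e \<in> S"
      then have "norm (z + inverse (real (Suc n)) *\<^sub>R e) \<le> R" using R by blast
      then have "norm z \<le> R + norm e"
        using n1 norm_diff_ineq[of z "inverse (real (Suc n)) *\<^sub>R e"] by linarith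
      then show False using False by (simp add: T_def)
    qed
    ultimately show ?thesis using False by (simp add: s_def h0)
  qed
  have lim: "(\<lambda>n. s n z) \<longlonglongrightarrow> h' z" for z
  proof -
    have "((\<lambda>u. (g (z + (0 + u) *\<^sub>R e) - g (z + 0 *\<^sub>R e)) / u) \<longlongrightarrow> G z e) (at 0)"
      using line[of z 0] unfolding DERIV_def by simp
    moreover have "filterlim (\<lambda>n. inverse (real (Suc n))) (at 0) sequentially"
      unfolding filterlim_at using LIMSEQ_inverse_real_of_nat by auto
    ultimately have "(\<lambda>n. (g (z + (0 + inverse (real (Suc n))) *\<^sub>R e) - g (z + 0 *\<^sub>R e)) / inverse (real (Suc n)))
        \<longlonglongrightarrow> G z e" by (rule filterlim_compose)
    then have "(\<lambda>n. a z * ((g (z + (0 + inverse (real (Suc n))) *\<^sub>R e) - g (z + 0 *\<^sub>R e)) / inverse (real (Suc n))))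
        \<longlonglongrightarrow> a z * G z e" by (intro tendsto_intros)
    moreover have "s n z = a z * ((g (z + (0 + inverse (real (Suc n))) *\<^sub>R e) - g (z + 0 *\<^sub>R e)) / inverse (real (Suc n)))" for n
      unfolding s_def h_def a_const by (simp add: field_simps)
    ultimately show ?thesis by (simp add: h'_def)
  qed
  have hi: "integrable lborel h" by (rule integrable_compact_support[OF S hc h0])
  have tr: "integrable lborel (\<lambda>z. h (z + v))" "(\<integral>z. h (z + v) \<partial>lborel) = (\<integral>z. h z \<partial>lborel)" for v
  proof -
    have d: "distr lborel borel ((+) v) = (lborel :: 'a measure)" by (rule lborel_distr_plus)
    have hm: "h \<in> borel_measurable borel" using hc by (rule borel_measurable_continuous_onI)
    have "integrable (distr lborel borel ((+) v)) h" using hi d by simp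
    then show "integrable lborel (\<lambda>z. h (z + v))"
      by (subst (asm) integrable_distr_eq) (use hm in \<open>auto simp: add.commute\<close>)
    have "(\<integral>z. h z \<partial>lborel) = (\<integral>z. h z \<partial>(distr lborel borel ((+) v)))" using d by simp
    also have "\<dots> = (\<integral>z. h (v + z) \<partial>lborel)" by (rule integral_distr) (use hm in auto)
    finally show "(\<integral>z. h (z + v) \<partial>lborel) = (\<integral>z. h z \<partial>lborel)" by (simp add: add.commute)
  qed
  have s0: "(\<integral>z. s n z \<partial>lborel) = 0" for n
    unfolding s_def using tr hi by simp
  have sm: "s n \<in> borel_measurable lborel" for n
    unfolding s_def using tr(1) hi by (intro borel_measurable_times borel_measurable_diff borel_measurable_const)
       (auto dest: borel_measurable_integrable)
  have "(\<lambda>n. \<integral>z. s n z \<partial>lborel) \<longlonglongrightarrow> (\<integral>z. h' z \<partial>lborel)"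
  proof (rule integral_dominated_convergence[where w="\<lambda>z. K * indicator T z"])
    show "h' \<in> borel_measurable lborel"
      using h'c by (auto intro: borel_measurable_continuous_onI)
    show "integrable lborel (\<lambda>z. K * indicator T z)"
      by (auto simp: T_def intro!: integrable_real_indicator emeasure_bounded_finite)
  qed (use sm lim sb in auto)
  then show "(\<integral>z. a z * G z e \<partial>lborel) = 0"
    unfolding s0 by (simp add: h'_def LIMSEQ_const_iff)
qed

subsection \<open>Local integrability of powers of the gauge\<close>

lemma gauge_nonneg [simp]: "0 \<le> gauge \<gamma> z"
  by (simp add: gauge_def)

lemma gauge_powr_eq:
  assumes "\<gamma> > 0"
  shows "gauge \<gamma> z powr (2 * (1 + \<gamma>))
    = norm (fst z) powr (2 * (1 + \<gamma>)) + (1 + \<gamma>)\<^sup>2 * (norm (snd z))\<^sup>2"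
  using assms by (simp add: gauge_def powr_powr)

lemma gauge_eq_0_iff [simp]: "\<gamma> > 0 \<Longrightarrow> gauge \<gamma> z = 0 \<longleftrightarrow> z = 0"
  by (auto simp: gauge_def add_nonneg_eq_0_iff prod_eq_iff)

lemma gauge_pos: "\<gamma> > 0 \<Longrightarrow> z \<noteq> 0 \<Longrightarrow> gauge \<gamma> z > 0"
  using gauge_eq_0_iff[of \<gamma> z] gauge_nonneg[of \<gamma> z] by linarith

lemma continuous_on_gauge:
  assumes "\<gamma> > 0" shows "continuous_on S (gauge \<gamma>)"
  unfolding gauge_def using assms
  by (intro continuous_on_powr' continuous_intros) auto

lemma borel_measurable_gauge [measurable]:
  "gauge \<gamma> \<in> borel_measurable (borel :: ('a::euclidean_space \<times> 'b::euclidean_space) measure)"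
  unfolding gauge_def borel_prod[symmetric] by measurable

lemma norm_fst_le_gauge:
  assumes "\<gamma> > 0" shows "norm (fst z) \<le> gauge \<gamma> z"
proof (rule ccontr)
  assume "\<not> ?thesis"
  then have "gauge \<gamma> z powr (2 * (1 + \<gamma>)) < norm (fst z) powr (2 * (1 + \<gamma>))"
    using assms by (intro powr_less_mono2) auto
  moreover have "0 \<le> (1 + \<gamma>)\<^sup>2 * (norm (snd z))\<^sup>2" by simp
  ultimately show False using gauge_powr_eq[OF assms, of z] by linarith
qed

lemma norm_snd_le_gauge:
  assumes "\<gamma> > 0" shows "norm (snd z) \<le> gauge \<gamma> z powr (1 + \<gamma>)"
proof -
  have "1 \<le> (1 + \<gamma>)\<^sup>2" using assms by (simp add: one_le_power)
  then have "(norm (snd z))\<^sup>2 \<le> (1 + \<gamma>)\<^sup>2 * (norm (snd z))\<^sup>2"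
    using mult_right_mono[of 1 "(1 + \<gamma>)\<^sup>2" "(norm (snd z))\<^sup>2"] by simp
  also have "\<dots> \<le> gauge \<gamma> z powr (2 * (1 + \<gamma>))" using gauge_powr_eq[OF assms, of z] by simp
  also have "\<dots> = (gauge \<gamma> z powr (1 + \<gamma>))\<^sup>2"
    by (simp add: power2_eq_square flip: powr_add)
  finally show ?thesis by (rule power2_le_imp_le) simp
qed

text \<open>Strictness comes from \<gamma> > 0, as Q is at least 2 + \<gamma>. For \<alpha> > 2 this
  places the exponents \<alpha> - 4 and -1 above -Q, which local integrability of the weights
  requires.\<close>

lemma hom_dim_gt_2:
  assumes "\<gamma> > 0"
  shows "hom_dim \<gamma> TYPE('a::euclidean_space) TYPE('b::euclidean_space) > 2"
proof -
  define m k where "m = real DIM('a)" and "k = real DIM('b)"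
  have "1 \<le> m" "1 \<le> k"
    using DIM_positive[where 'a='a] DIM_positive[where 'a='b] unfolding m_def k_def by linarith+
  have "1 + \<gamma> \<le> (1 + \<gamma>) * k" using \<open>1 \<le> k\<close> assms by simp
  moreover have "2 < m + t" if "1 + \<gamma> \<le> t" for t using \<open>1 \<le> m\<close> assms that by linarith
  ultimately have "2 < m + (1 + \<gamma>) * k" by blast
  then show ?thesis by (simp add: hom_dim_def m_def k_def)
qed

text \<open>A gauge ball lies in a product of Euclidean balls of radii \<open>r\<close> and
  \<open>r powr (1 + \<gamma>)\<close>; the exponents of their volumes add up to the homogeneous
  dimension.\<close>

lemma emeasure_gauge_le:
  assumes "\<gamma> > 0" "r > 0"
  shows "emeasure lborel {z :: 'a::euclidean_space \<times> 'b::euclidean_space. gauge \<gamma> z \<le> r}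
    \<le> ennreal (unit_ball_vol (real DIM('a)) * unit_ball_vol (real DIM('b))
               * r powr hom_dim \<gamma> TYPE('a) TYPE('b))"
proof -
  have "{z :: 'a \<times> 'b. gauge \<gamma> z \<le> r} \<subseteq> cball 0 r \<times> cball 0 (r powr (1 + \<gamma>))"
  proof (clarsimp, intro conjI)
    fix x :: 'a and y :: 'b assume le: "gauge \<gamma> (x, y) \<le> r"
    show "norm x \<le> r" using norm_fst_le_gauge[OF assms(1), of "(x, y)"] le by simp
    have "norm y \<le> gauge \<gamma> (x, y) powr (1 + \<gamma>)"
      using norm_snd_le_gauge[OF assms(1), of "(x, y)"] by simp
    also have "\<dots> \<le> r powr (1 + \<gamma>)" using le assms by (intro powr_mono2) auto
    finally show "norm y \<le> r powr (1 + \<gamma>)" .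
  qed
  then have "emeasure lborel {z :: 'a \<times> 'b. gauge \<gamma> z \<le> r}
      \<le> emeasure lborel (cball (0::'a) r \<times> cball (0::'b) (r powr (1 + \<gamma>)))"
    by (intro emeasure_mono) (auto simp: borel_Times)
  also have "\<dots> = emeasure (lborel \<Otimes>\<^sub>M lborel) (cball (0::'a) r \<times> cball (0::'b) (r powr (1 + \<gamma>)))"
    by (simp add: lborel_prod)
  also have "\<dots> = emeasure lborel (cball (0::'a) r) * emeasure lborel (cball (0::'b) (r powr (1 + \<gamma>)))"
    by (intro lborel.emeasure_pair_measure_Times) auto
  also have "\<dots> = ennreal (unit_ball_vol (real DIM('a)) * unit_ball_vol (real DIM('b))
               * (r ^ DIM('a) * (r powr (1 + \<gamma>)) ^ DIM('b)))"
    using assms by (simp add: emeasure_cball ennreal_mult[symmetric] mult_ac)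
  also have "r ^ DIM('a) * (r powr (1 + \<gamma>)) ^ DIM('b) = r powr hom_dim \<gamma> TYPE('a) TYPE('b)"
  proof -
    have "(r powr (1 + \<gamma>)) ^ DIM('b) = (r powr (1 + \<gamma>)) powr real DIM('b)"
      by (rule powr_realpow[symmetric]) (use assms in simp)
    also have "\<dots> = r powr ((1 + \<gamma>) * real DIM('b))" by (rule powr_powr)
    finally show ?thesis
      unfolding hom_dim_def powr_add using powr_realpow[OF assms(2)] by simp
  qed
  finally show ?thesis .
qed

text \<open>Local integrability comes from a decomposition into the dyadic gauge shells
  \<open>2\<^sup>-\<^sup>j\<^sup>-\<^sup>1 < \<rho> \<le> 2\<^sup>-\<^sup>j\<close>, whose volumes decay like \<open>2\<^sup>-\<^sup>j\<^sup>Q\<close>.\<close>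
lemma integrable_gauge_powr:
  fixes S :: "('a::euclidean_space \<times> 'b::euclidean_space) set"
  assumes "\<gamma> > 0" and \<beta>: "- hom_dim \<gamma> TYPE('a) TYPE('b) < \<beta>"
    and S: "bounded S" "S \<in> sets borel"
  shows "integrable lborel (\<lambda>z. indicator S z * gauge \<gamma> z powr \<beta>)"
proof -
  define Q where "Q = hom_dim \<gamma> TYPE('a) TYPE('b)"
  define V where "V = unit_ball_vol (real DIM('a)) * unit_ball_vol (real DIM('b))"
  have V0: "V \<ge> 0" by (simp add: V_def)
  obtain M where M: "M \<ge> 1" "\<And>z. z \<in> S \<Longrightarrow> gauge \<gamma> z \<le> M"
  proof -
    have "compact (gauge \<gamma> ` closure S)"
      using S continuous_on_gauge[OF assms(1)] by (intro compact_continuous_image) auto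
    then obtain M where "\<forall>x\<in>gauge \<gamma> ` closure S. norm x \<le> M"
      using compact_imp_bounded bounded_iff by metis
    then show ?thesis using closure_subset[of S] by (intro that[of "max 1 M"]) (auto simp: le_max_iff_disj)
  qed
  \<comment> \<open>Full gauge balls stand in for the shells: this only enlarges the series and lets
    \<open>emeasure_gauge_le\<close> apply directly.\<close>
  define D where "D j = {z :: 'a \<times> 'b. gauge \<gamma> z \<le> (1/2) ^ j}" for j :: nat
  have Dm[measurable]: "D j \<in> sets borel" for j
    unfolding D_def by measurable
  have fin: "(\<integral>\<^sup>+ z. ennreal (indicator S z * gauge \<gamma> z powr \<beta>) \<partial>lborel) < \<infinity>"
  proof (cases "\<beta> \<ge> 0")
    case True
    have "(\<integral>\<^sup>+ z. ennreal (indicator S z * gauge \<gamma> z powr \<beta>) \<partial>lborel)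
        \<le> (\<integral>\<^sup>+ z. ennreal (M powr \<beta>) * indicator S z \<partial>lborel)"
      using True M by (intro nn_integral_mono) (auto simp: indicator_def intro!: powr_mono2)
    also have "\<dots> = ennreal (M powr \<beta>) * emeasure lborel S"
      using S by (simp add: nn_integral_cmult_indicator)
    also have "\<dots> < \<infinity>" using emeasure_bounded_finite[OF S(1)] by (simp add: ennreal_mult_less_top)
    finally show ?thesis .
  next
    case False
    have term_le: "f j \<le> suminf f" for f :: "nat \<Rightarrow> ennreal" and j
      using sum_le_suminf[of f "{j}"] by simp
    \<comment> \<open>For \<beta> < 0 the power is largest at the inner radius of the shell, which
      is 1/2 to the power j + 1; hence \<open>Suc j\<close>.\<close>
    define c where "c j = (1/2::real) powr (\<beta> * real (Suc j))" for j
    have bound: "ennreal (indicator S z * gauge \<gamma> z powr \<beta>)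
        \<le> indicator S z + (\<Sum>j. ennreal (c j) * indicator (D j) z)" for z
    proof (cases "z \<in> S \<and> 0 < gauge \<gamma> z \<and> gauge \<gamma> z < 1")
      case True
      define g where "g = gauge \<gamma> z"
      have g: "0 < g" "g < 1" using True by (auto simp: g_def)
      define j where "j = nat \<lfloor>log (1/2) g\<rfloor>"
      have l0: "log (1/2) g > 0" using g by (simp add: log_def divide_neg_neg)
      have j1: "real j \<le> log (1/2) g" and j2: "log (1/2) g < real (Suc j)"
        using l0 unfolding j_def by linarith+
      have gl: "g = (1/2) powr (log (1/2) g)" using g by simp
      have "g \<le> (1/2) powr (real j)"
        by (subst gl) (use j1 in \<open>simp add: powr_le_cancel_iff powr_mono'\<close>)
      then have zD: "z \<in> D j" by (simp add: D_def g_def powr_realpow)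
      have "(1/2) powr (real (Suc j)) \<le> g"
        by (subst gl) (use j2 in \<open>intro powr_mono'; simp\<close>)
      then have "g powr \<beta> \<le> ((1/2) powr (real (Suc j))) powr \<beta>"
        using False by (intro powr_mono2') auto
      also have "\<dots> = c j" by (simp add: c_def powr_powr mult.commute)
      finally have "ennreal (indicator S z * gauge \<gamma> z powr \<beta>) \<le> ennreal (c j) * indicator (D j) z"
        using zD by (auto simp: g_def indicator_def intro!: ennreal_leI)
      also have "\<dots> \<le> (\<Sum>j. ennreal (c j) * indicator (D j) z)"
        by (rule term_le)
      also have "\<dots> \<le> indicator S z + (\<Sum>j. ennreal (c j) * indicator (D j) z)" by simp
      finally show ?thesis .
    next
      case out: False
      \<comment> \<open>The origin causes no trouble because \<open>0 powr \<beta> = 0\<close>; at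
        the other points of \<open>S\<close> left over, the gauge is at least 1 and \<beta> is
        negative.\<close>
      have "indicator S z * gauge \<gamma> z powr \<beta> \<le> indicator S z"
      proof (cases "z \<in> S \<and> gauge \<gamma> z \<noteq> 0")
        case True
        then have "1 \<le> gauge \<gamma> z" using out gauge_nonneg[of \<gamma> z] by linarith
        then have "gauge \<gamma> z powr \<beta> \<le> 1 powr \<beta>" using False by (intro powr_mono2') auto
        then show ?thesis by (simp add: indicator_def)
      qed (auto simp: indicator_def)
      then have "ennreal (indicator S z * gauge \<gamma> z powr \<beta>) \<le> ennreal (indicator S z)" by (rule ennreal_leI)
      then show ?thesis by (simp add: ennreal_indicator add_increasing2)
    qed
    have "(\<integral>\<^sup>+ z. ennreal (indicator S z * gauge \<gamma> z powr \<beta>) \<partial>lborel)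
        \<le> (\<integral>\<^sup>+ z. indicator S z + (\<Sum>j. ennreal (c j) * indicator (D j) z) \<partial>lborel)"
      by (intro nn_integral_mono bound)
    also have "\<dots> = emeasure lborel S + (\<Sum>j. ennreal (c j) * emeasure lborel (D j))"
      using S by (simp add: nn_integral_add nn_integral_suminf nn_integral_cmult_indicator)
    also have "\<dots> < \<infinity>"
    proof -
      \<comment> \<open>The bound on a shell times its volume is geometric in \<open>j\<close> with
        ratio \<open>r\<close>, and \<open>r < 1\<close> amounts to \<beta> > -Q.\<close>
      define r where "r = (1/2::real) powr (\<beta> + Q)"
      have r: "0 \<le> r" "r < 1"
        using powr_less_mono'[of "1/2" 0 "\<beta> + Q"] \<beta> by (auto simp: r_def Q_def)
      have "ennreal (c j) * emeasure lborel (D j) \<le> ennreal (V * (1/2) powr \<beta> * r ^ j)" for j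
      proof -
        have "ennreal (c j) * emeasure lborel (D j) \<le> ennreal (c j) * ennreal (V * ((1/2) ^ j) powr Q)"
          unfolding D_def V_def Q_def by (intro mult_left_mono emeasure_gauge_le assms) auto
        also have "\<dots> = ennreal (c j * (V * ((1/2) ^ j) powr Q))"
          using V0 by (intro ennreal_mult[symmetric]) (auto simp: c_def)
        also have "c j * (V * ((1/2) ^ j) powr Q) = V * (1/2) powr \<beta> * r ^ j"
          by (simp add: c_def r_def powr_realpow[symmetric] powr_powr powr_add[symmetric] algebra_simps
              flip: powr_add)
        finally show ?thesis .
      qed
      then have "(\<Sum>j. ennreal (c j) * emeasure lborel (D j)) \<le> (\<Sum>j. ennreal (V * (1/2) powr \<beta> * r ^ j))"
        by (intro suminf_le) auto
      also have "\<dots> = ennreal (\<Sum>j. V * (1/2) powr \<beta> * r ^ j)"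
        using r V0 by (intro suminf_ennreal2) (auto intro!: summable_mult summable_geometric)
      finally have "(\<Sum>j. ennreal (c j) * emeasure lborel (D j)) < \<infinity>"
        by (simp add: order.strict_trans1)
      then show ?thesis using emeasure_bounded_finite[OF S(1)] by simp
    qed
    finally show ?thesis .
  qed
  have "(\<lambda>z. indicator S z * gauge \<gamma> z powr \<beta>) \<in> borel_measurable lborel"
    using S by measurable
  then show ?thesis
    using fin by (intro integrableI_nonneg) auto
qed

subsection \<open>Test functions and divergence identities\<close>

text \<open>The derivative along the generator of the anisotropic dilations, so that
  \<open>\<nabla>\<^sub>\<gamma>\<rho> \<bullet> \<nabla>\<^sub>\<gamma>f\<close> equals \<open>|\<nabla>\<^sub>\<gamma>\<rho>|\<^sup>2 / \<rho>\<close> times \<open>euler_deriv \<gamma> f\<close>.\<close>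
definition euler_deriv :: "real \<Rightarrow> ('a::euclidean_space \<times> 'b::euclidean_space \<Rightarrow> real) \<Rightarrow> 'a \<times> 'b \<Rightarrow> real" where
  "euler_deriv \<gamma> f z = frechet_derivative f (at z) (fst z, (1 + \<gamma>) *\<^sub>R snd z)"

lemma Cinf0_has_derivative:
  assumes "Cinf0 \<Omega> f"
  shows "(f has_derivative frechet_derivative f (at z)) (at z)"
    and "e \<in> Basis \<Longrightarrow> ((\<lambda>z. frechet_derivative f (at z) e) has_derivative
      frechet_derivative (\<lambda>z. frechet_derivative f (at z) e) (at z)) (at z)"
    and "e \<in> Basis \<Longrightarrow> continuous_on UNIV (\<lambda>z. frechet_derivative f (at z) e)"
    and "e \<in> Basis \<Longrightarrow> continuous_on UNIV (dd [e, e] f)"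
    and "continuous_on UNIV f"
proof -
  have d: "dd vs f differentiable at z" if "set vs \<subseteq> Basis" for vs z
    using assms that by (auto simp: Cinf0_def Cinf_on_def)
  then have c: "continuous_on UNIV (dd vs f)" if "set vs \<subseteq> Basis" for vs
    using that by (intro continuous_at_imp_continuous_on ballI differentiable_imp_continuous_within) auto
  show "(f has_derivative frechet_derivative f (at z)) (at z)"
    using d[of "[]"] by (simp add: frechet_derivative_works)
  show "((\<lambda>z. frechet_derivative f (at z) e) has_derivative
      frechet_derivative (\<lambda>z. frechet_derivative f (at z) e) (at z)) (at z)" if "e \<in> Basis"
    using d[of "[e]"] that by (simp add: frechet_derivative_works)
  show "continuous_on UNIV (\<lambda>z. frechet_derivative f (at z) e)" if "e \<in> Basis"
    using c[of "[e]"] that by simp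
  show "continuous_on UNIV (dd [e, e] f)" if "e \<in> Basis"
    using c[of "[e, e]"] that by (simp del: dd.simps)
  show "continuous_on UNIV f" using c[of "[]"] by simp
qed

text \<open>The witness is the closed support. Its complement is open, so first and second
  derivatives vanish there along with \<open>f\<close>.\<close>

lemma Cinf0_support:
  assumes "Cinf0 \<Omega> f"
  obtains S where "compact S" "S \<subseteq> \<Omega>" "\<And>z. z \<notin> S \<Longrightarrow> f z = 0"
    "\<And>z. z \<notin> S \<Longrightarrow> frechet_derivative f (at z) = (\<lambda>_. 0)"
    "\<And>z e. z \<notin> S \<Longrightarrow> dd [e, e] f z = 0"
proof -
  define S where "S = closure {z. f z \<noteq> 0}"
  have op: "open (- S)" by (simp add: S_def open_Compl)
  have zero: "frechet_derivative g (at z) = (\<lambda>_. 0)" if "z \<notin> S" "\<And>w. w \<notin> S \<Longrightarrow> g w = 0" for g :: "'a \<Rightarrow> real" and z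
  proof -
    have "(g has_derivative (\<lambda>_. 0)) (at z)"
      by (rule has_derivative_transform_within_open[rotated 1, where f="\<lambda>_. 0", OF op])
         (use that in auto)
    then show ?thesis by (rule frechet_derivative_at[symmetric])
  qed
  have f0: "f z = 0" if "z \<notin> S" for z
    using that closure_subset[of "{z. f z \<noteq> 0}"] by (auto simp: S_def)
  have f1: "frechet_derivative f (at z) = (\<lambda>_. 0)" if "z \<notin> S" for z
    by (rule zero) (use that f0 in auto)
  show ?thesis
  proof (rule that[of S])
    show "compact S" "S \<subseteq> \<Omega>" using assms by (auto simp: S_def Cinf0_def)
    show "dd [e, e] f z = 0" if "z \<notin> S" for z e
      using zero[OF that, of "\<lambda>z. frechet_derivative f (at z) e"] f1 by simp
  qed (use f0 f1 in auto)
qed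

lemma linear_fst_snd_expansion:
  fixes L :: "'a::euclidean_space \<times> 'b::euclidean_space \<Rightarrow> real"
  assumes "linear L"
  shows "L (x, y) = (\<Sum>e\<in>Basis. (x \<bullet> e) * L (e, 0)) + (\<Sum>e\<in>Basis. (y \<bullet> e) * L (0, e))"
proof -
  have 1: "linear (\<lambda>x. L (x, 0))" "linear (\<lambda>y. L (0, y))"
    using linear_compose[of "\<lambda>x. (x, 0)" L] linear_compose[of "\<lambda>y. (0, y)" L] assms
    by (auto simp: o_def linear_iff)
  have "L (x, y) = L (x, 0) + L (0, y)"
    using linear_add[OF assms, of "(x, 0)" "(0, y)"] by simp
  also have "L (x, 0) = L (\<Sum>e\<in>Basis. (x \<bullet> e) *\<^sub>R e, 0)" by (simp add: euclidean_representation)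
  also have "\<dots> = (\<Sum>e\<in>Basis. (x \<bullet> e) * L (e, 0))"
    using linear_sum[OF 1(1), of "\<lambda>e. (x \<bullet> e) *\<^sub>R e" Basis] linear_cmul[OF 1(1)] by simp
  also have "L (0, y) = L (0, \<Sum>e\<in>Basis. (y \<bullet> e) *\<^sub>R e)" by (simp add: euclidean_representation)
  also have "\<dots> = (\<Sum>e\<in>Basis. (y \<bullet> e) * L (0, e))"
    using linear_sum[OF 1(2), of "\<lambda>e. (y \<bullet> e) *\<^sub>R e" Basis] linear_cmul[OF 1(2)] by simp
  finally show ?thesis .
qed

text \<open>The divergence theorem for the field \<open>c f^2 (x, (1 + \<gamma>) y)\<close>: the
  generator of the anisotropic dilations has divergence Q. Here \<open>c\<close> has to be
  differentiable everywhere, so singular weights are reached only by approximation.\<close>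

lemma dilation_divergence_identity:
  fixes f :: "'a::euclidean_space \<times> 'b::euclidean_space \<Rightarrow> real"
  assumes f: "Cinf0 \<Omega> f"
    and c: "\<And>z. (c has_derivative c' z) (at z)"
    and c': "\<And>e. e \<in> Basis \<Longrightarrow> continuous_on UNIV (\<lambda>z. c' z e)"
  shows "has_bochner_integral lborel (\<lambda>z.
      (c' z (fst z, (1 + \<gamma>) *\<^sub>R snd z) + hom_dim \<gamma> TYPE('a) TYPE('b) * c z) * (f z)\<^sup>2
      + 2 * c z * f z * euler_deriv \<gamma> f z) 0"
proof -
  obtain S where S: "compact S" "\<And>z. z \<notin> S \<Longrightarrow> f z = 0" using Cinf0_support[OF f] by metis
  define D where "D z = frechet_derivative f (at z)" for z
  have D: "(f has_derivative D z) (at z)" for z using Cinf0_has_derivative(1)[OF f] by (simp add: D_def)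
  have Dc: "continuous_on UNIV (\<lambda>z. D z e)" if "e \<in> Basis" for e
    using Cinf0_has_derivative(3)[OF f that] by (simp add: D_def)
  have fc: "continuous_on UNIV f" by (rule Cinf0_has_derivative(5)[OF f])
  have cc: "continuous_on UNIV c"
    using c by (meson continuous_at_imp_continuous_on has_derivative_continuous)
  define L where "L z h = c' z h * (f z)\<^sup>2 + c z * (2 * f z * D z h)" for z h
  have Llin: "linear (L z)" for z
    using has_derivative_linear[OF c, of z] has_derivative_linear[OF D, of z]
    by (auto simp: L_def linear_iff algebra_simps)
  have Lc: "continuous_on UNIV (\<lambda>z. L z e)" if "e \<in> Basis" for e
    unfolding L_def using that by (intro continuous_intros c' Dc fc cc)
  \<comment> \<open>The field is treated one coordinate at a time. Later \<open>l\<close> is the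
    inner product with \<open>e\<close>, so \<open>l e = 1\<close>; summing these ones, with factor
    1 + \<gamma> in the y directions, produces Q.\<close>
  have coord: "has_bochner_integral lborel (\<lambda>z. l e * (c z * (f z)\<^sup>2) + l z * L z e) 0"
    if "e \<in> Basis" "bounded_linear l" for l :: "'a \<times> 'b \<Rightarrow> real" and e
  proof -
    define G where "G z h = l h * (c z * (f z)\<^sup>2) + l z * L z h" for z h
    have lc: "continuous_on UNIV l" using that(2) by (simp add: linear_continuous_on)
    have "((\<lambda>z. l z * (c z * (f z)\<^sup>2)) has_derivative G z) (at z)" for z
      unfolding G_def L_def
      by (rule derivative_eq_intros c D bounded_linear_imp_has_derivative[OF that(2)] refl)+
         (simp add: fun_eq_iff algebra_simps)
    moreover have "continuous_on UNIV (\<lambda>z. G z e)"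
      unfolding G_def by (intro continuous_intros fc cc lc Lc that)
    ultimately have "integrable lborel (\<lambda>z. 1 * G z e)" "(\<integral>z. 1 * G z e \<partial>lborel) = 0"
      using integral_directional_derivative_eq_0[OF S(1), of "\<lambda>z. l z * (c z * (f z)\<^sup>2)" G e "\<lambda>_. 1"] S(2)
      by auto
    then show ?thesis by (simp add: has_bochner_integral_iff G_def)
  qed
  have x: "has_bochner_integral lborel (\<lambda>z. c z * (f z)\<^sup>2 + (z \<bullet> (e, 0)) * L z (e, 0)) 0" if "e \<in> Basis" for e :: 'a
    using coord[OF _ bounded_linear_inner_left, of "(e, 0)" "(e, 0)"] that by (simp add: Basis_prod_def)
  have y: "has_bochner_integral lborel (\<lambda>z. c z * (f z)\<^sup>2 + (z \<bullet> (0, e)) * L z (0, e)) 0" if "e \<in> Basis" for e :: 'b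
    using coord[OF _ bounded_linear_inner_left, of "(0, e)" "(0, e)"] that by (simp add: Basis_prod_def)
  have "has_bochner_integral lborel (\<lambda>z.
      (\<Sum>e\<in>Basis. c z * (f z)\<^sup>2 + (z \<bullet> (e, 0)) * L z (e, 0))
      + (1 + \<gamma>) * (\<Sum>e\<in>Basis. c z * (f z)\<^sup>2 + (z \<bullet> (0, e)) * L z (0, e)))
      ((\<Sum>e\<in>(Basis::'a set). 0) + (1 + \<gamma>) * (\<Sum>e\<in>(Basis::'b set). 0))"
    by (intro has_bochner_integral_add has_bochner_integral_mult_right has_bochner_integral_sum x y)
  moreover have "(\<Sum>e\<in>Basis. c z * (f z)\<^sup>2 + (z \<bullet> (e, 0)) * L z (e, 0))
      + (1 + \<gamma>) * (\<Sum>e\<in>Basis. c z * (f z)\<^sup>2 + (z \<bullet> (0, e)) * L z (0, e))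
     = (c' z (fst z, (1 + \<gamma>) *\<^sub>R snd z) + hom_dim \<gamma> TYPE('a) TYPE('b) * c z) * (f z)\<^sup>2
      + 2 * c z * f z * euler_deriv \<gamma> f z" (is "?l = ?r") for z
  proof -
    have "?l = hom_dim \<gamma> TYPE('a) TYPE('b) * (c z * (f z)\<^sup>2)
       + ((\<Sum>e\<in>Basis. (fst z \<bullet> e) * L z (e, 0))
       + (\<Sum>e\<in>Basis. ((1 + \<gamma>) *\<^sub>R snd z \<bullet> e) * L z (0, e)))"
      by (simp add: sum.distrib hom_dim_def inner_prod_def algebra_simps sum_distrib_left)
    also have "\<dots> = hom_dim \<gamma> TYPE('a) TYPE('b) * (c z * (f z)\<^sup>2) + L z (fst z, (1 + \<gamma>) *\<^sub>R snd z)"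
      by (subst linear_fst_snd_expansion[OF Llin]) (rule refl)
    also have "\<dots> = ?r" by (simp add: L_def euler_deriv_def D_def algebra_simps)
    finally show ?thesis .
  qed
  ultimately show ?thesis by simp
qed

text \<open>The integrand is the horizontal divergence of \<open>v f\<close> times the horizontal
  gradient of \<open>f\<close>, expanded by the product rule.\<close>

lemma grushin_green_identity:
  fixes f :: "'a::euclidean_space \<times> 'b::euclidean_space \<Rightarrow> real"
  assumes f: "Cinf0 \<Omega> f" and "\<gamma> > 0"
    and v: "\<And>z. (v has_derivative v' z) (at z)"
    and v': "\<And>e. e \<in> Basis \<Longrightarrow> continuous_on UNIV (\<lambda>z. v' z e)"
  shows "has_bochner_integral lborel (\<lambda>z.
      v z * f z * grushin_laplacian \<gamma> f z + v z * grad_gamma_sq \<gamma> f z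
      + f z * ((\<Sum>e\<in>Basis. v' z (e, 0) * frechet_derivative f (at z) (e, 0))
        + norm (fst z) powr (2 * \<gamma>) * (\<Sum>e\<in>Basis. v' z (0, e) * frechet_derivative f (at z) (0, e)))) 0"
proof -
  obtain S where S: "compact S" "\<And>z. z \<notin> S \<Longrightarrow> f z = 0" using Cinf0_support[OF f] by metis
  define D where "D e z = frechet_derivative f (at z) e" for z e
  have D: "(f has_derivative (\<lambda>h. D h z)) (at z)" for z using Cinf0_has_derivative(1)[OF f] by (simp add: D_def)
  have Dc: "continuous_on UNIV (D e)" if "e \<in> Basis" for e
    using Cinf0_has_derivative(3)[OF f that] by (simp add: D_def[abs_def])
  have D2: "(D e has_derivative frechet_derivative (D e) (at z)) (at z)" if "e \<in> Basis" for e z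
    using Cinf0_has_derivative(2)[OF f that] by (simp add: D_def[abs_def])
  have D2c: "continuous_on UNIV (\<lambda>z. frechet_derivative (D e) (at z) e)" if "e \<in> Basis" for e
    using Cinf0_has_derivative(4)[OF f that] by (simp add: D_def[abs_def])
  have fc: "continuous_on UNIV f" by (rule Cinf0_has_derivative(5)[OF f])
  have vc: "continuous_on UNIV v"
    using v by (meson continuous_at_imp_continuous_on has_derivative_continuous)
  define F where "F e z = v' z e * f z * D e z + v z * (D e z)\<^sup>2 + v z * f z * dd [e, e] f z" for e z
  have coord: "has_bochner_integral lborel (\<lambda>z. a z * F e z) 0"
    if "e \<in> Basis" "continuous_on UNIV a" "\<And>z t. a (z + t *\<^sub>R e) = a z" for a e
  proof -
    define G where "G z h = v' z h * f z * D e z + v z * D h z * D e z + v z * f z * frechet_derivative (D e) (at z) h" for z h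
    have "((\<lambda>z. v z * f z * D e z) has_derivative G z) (at z)" for z
      unfolding G_def
      by (rule derivative_eq_intros v D D2[OF that(1)] refl)+
         (simp add: fun_eq_iff algebra_simps)
    moreover have "continuous_on UNIV (\<lambda>z. G z e)"
      unfolding G_def by (intro continuous_intros fc vc v' Dc D2c that)
    ultimately have "integrable lborel (\<lambda>z. a z * G z e)" "(\<integral>z. a z * G z e \<partial>lborel) = 0"
      using integral_directional_derivative_eq_0[OF S(1), of "\<lambda>z. v z * f z * D e z" G e a] S(2) that
      by auto
    moreover have "G z e = F e z" for z by (simp add: G_def F_def D_def[abs_def] power2_eq_square)
    ultimately show ?thesis by (simp add: has_bochner_integral_iff)
  qed
  \<comment> \<open>The coefficient |x|^(2\<gamma>) depends on x only, hence is constant along the y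
    directions and may serve as \<open>a\<close> there; the x directions use the constant 1.\<close>
  have "has_bochner_integral lborel (\<lambda>z. (\<Sum>e\<in>(Basis::'a set). 1 * F (e, 0) z)
      + (\<Sum>e\<in>(Basis::'b set). norm (fst z) powr (2 * \<gamma>) * F (0, e) z))
      ((\<Sum>e\<in>(Basis::'a set). 0) + (\<Sum>e\<in>(Basis::'b set). 0))"
    using \<open>\<gamma> > 0\<close>
    by (intro has_bochner_integral_add has_bochner_integral_sum coord continuous_on_powr' continuous_intros)
      (auto simp: Basis_prod_def)
  moreover have "(norm (fst z) powr \<gamma>)\<^sup>2 = norm (fst z) powr (2 * \<gamma>)" for z :: "'a \<times> 'b"
    by (simp add: power2_eq_square flip: powr_add)
  ultimately show ?thesis
    by (simp add: F_def D_def grushin_laplacian_def grad_gamma_sq_def sum.distrib sum_distrib_left algebra_simps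
        del: dd.simps)
qed

section \<open>Continuity of the differential expressions and integrability against weights\<close>

lemma continuous_on_euler_deriv:
  fixes f :: "'a::euclidean_space \<times> 'b::euclidean_space \<Rightarrow> real"
  assumes "Cinf0 \<Omega> f" shows "continuous_on UNIV (euler_deriv \<gamma> f)"
proof -
  \<comment> \<open>Continuity of derivatives is available along basis vectors only, hence the
    expansion.\<close>
  have "euler_deriv \<gamma> f z = (\<Sum>e\<in>Basis. (fst z \<bullet> e) * frechet_derivative f (at z) (e, 0))
      + (\<Sum>e\<in>Basis. ((1 + \<gamma>) *\<^sub>R snd z \<bullet> e) * frechet_derivative f (at z) (0, e))" for z
    unfolding euler_deriv_def
    by (intro linear_fst_snd_expansion has_derivative_linear[OF Cinf0_has_derivative(1)[OF assms]])
  then have eq: "euler_deriv \<gamma> f = (\<lambda>z. (\<Sum>e\<in>Basis. (fst z \<bullet> e) * frechet_derivative f (at z) (e, 0))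
      + (\<Sum>e\<in>Basis. ((1 + \<gamma>) *\<^sub>R snd z \<bullet> e) * frechet_derivative f (at z) (0, e)))"
    by blast
  show ?thesis unfolding eq
    by (intro continuous_intros Cinf0_has_derivative(3)[OF assms]) (auto simp: Basis_prod_def)
qed

lemma norm_powr_sq: "(norm x powr \<gamma>)\<^sup>2 = norm x powr (2 * \<gamma>)" for x :: "'a::real_normed_vector"
  by (simp add: power2_eq_square flip: powr_add)

lemma inner_self_powr: "(x \<bullet> x) powr \<gamma> = norm x powr (2 * \<gamma>)" for x :: "'a::real_inner"
proof -
  have "x \<bullet> x = norm x powr 2" by (simp add: dot_square_norm)
  then show ?thesis by (simp only: powr_powr)
qed

lemma continuous_on_grad_gamma_sq:
  assumes "Cinf0 \<Omega> f" "\<gamma> > 0" shows "continuous_on UNIV (grad_gamma_sq \<gamma> f)"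
  unfolding grad_gamma_sq_def[abs_def] using assms(2)
  by (intro continuous_intros continuous_on_powr' Cinf0_has_derivative(3)[OF assms(1)]) (auto simp: Basis_prod_def)

lemma continuous_on_grushin_laplacian:
  assumes "Cinf0 \<Omega> f" "\<gamma> > 0" shows "continuous_on UNIV (grushin_laplacian \<gamma> f)"
  unfolding grushin_laplacian_def[abs_def] using assms(2)
  by (intro continuous_intros continuous_on_powr' Cinf0_has_derivative(4)[OF assms(1)]) (auto simp: Basis_prod_def)

text \<open>The set x = 0 lies in a hyperplane. Discarding it matters because the limits of the
  regularised weights and the formula for the gradient of the gauge are established only where x is
  nonzero.\<close>

lemma AE_fst_neq_0: "AE z in (lborel :: ('a::euclidean_space \<times> 'b::euclidean_space) measure). fst z \<noteq> 0"
proof -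
  obtain e :: 'a where e: "e \<in> Basis" using nonempty_Basis by blast
  have "{z :: 'a \<times> 'b. fst z = 0} \<subseteq> {z. (e, 0) \<bullet> z = 0}" by (auto simp: inner_prod_def)
  moreover have "negligible {z :: 'a \<times> 'b. (e, 0) \<bullet> z = 0}"
    using e by (intro negligible_hyperplane) (auto simp: prod_eq_iff)
  ultimately have "negligible {z :: 'a \<times> 'b. fst z = 0}" by (rule negligible_subset[rotated])
  moreover have "{z :: 'a \<times> 'b. fst z = 0} \<in> sets borel"
    by (intro borel_closed closed_Collect_eq continuous_intros)
  ultimately have "{z :: 'a \<times> 'b. fst z = 0} \<in> null_sets lborel"
    by (simp add: negligible_iff_null_sets null_sets_completion_iff)
  then show ?thesis by (rule AE_I') auto
qed

text \<open>Continuity bounds \<open>h\<close> on its compact support, so a multiple of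
  \<rho>^\<beta> on \<open>S\<close> dominates the product. A general \<open>k\<close> serves both
  the power of the gauge and the degenerate weight defined next.\<close>

lemma integrable_gauge_weight:
  fixes h :: "'a::euclidean_space \<times> 'b::euclidean_space \<Rightarrow> real"
  assumes "\<gamma> > 0" "- hom_dim \<gamma> TYPE('a) TYPE('b) < \<beta>"
    and S: "compact S" and h: "continuous_on UNIV h" "\<And>z. z \<notin> S \<Longrightarrow> h z = 0"
    and k: "k \<in> borel_measurable borel" "\<And>z. \<bar>k z\<bar> \<le> gauge \<gamma> z powr \<beta>"
  shows "integrable lborel (\<lambda>z. k z * h z)"
proof -
  have "bounded (h ` S)"
    using S h by (meson compact_continuous_image compact_imp_bounded continuous_on_subset subset_UNIV)
  then obtain K where K: "\<forall>x\<in>h ` S. norm x \<le> K" unfolding bounded_iff by blast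
  have hm: "h \<in> borel_measurable borel" using h by (simp add: borel_measurable_continuous_onI)
  show ?thesis
  proof (rule Bochner_Integration.integrable_bound)
    show "integrable lborel (\<lambda>z. K * (indicator S z * gauge \<gamma> z powr \<beta>))"
      using S by (intro integrable_mult_right integrable_gauge_powr assms)
        (auto intro: compact_imp_bounded borel_closed compact_imp_closed)
    show "(\<lambda>z. k z * h z) \<in> borel_measurable lborel" using k hm by simp
    have "\<bar>k z * h z\<bar> \<le> \<bar>K * (indicator S z * gauge \<gamma> z powr \<beta>)\<bar>" for z
    proof (cases "z \<in> S")
      case True
      then have "\<bar>h z\<bar> \<le> K" using K by auto
      then have "\<bar>k z\<bar> * \<bar>h z\<bar> \<le> gauge \<gamma> z powr \<beta> * K" using k(2) by (intro mult_mono) auto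
      then have "\<bar>k z * h z\<bar> \<le> K * gauge \<gamma> z powr \<beta>" by (simp add: abs_mult mult.commute)
      also have "\<dots> \<le> \<bar>K * (indicator S z * gauge \<gamma> z powr \<beta>)\<bar>" using True by simp
      finally show ?thesis .
    qed (simp add: h)
    then show "AE z in lborel. norm (k z * h z) \<le> norm (K * (indicator S z * gauge \<gamma> z powr \<beta>))"
      by simp
  qed
qed

text \<open>Almost everywhere, \<open>gauge_weight \<gamma> \<beta>\<close> is \<open>\<rho>\<^sup>\<beta> |\<nabla>\<^sub>\<gamma>\<rho>|\<^sup>2\<close>.\<close>
definition gauge_weight :: "real \<Rightarrow> real \<Rightarrow> 'a::euclidean_space \<times> 'b::euclidean_space \<Rightarrow> real" where
  "gauge_weight \<gamma> \<beta> z = gauge \<gamma> z powr (\<beta> - 2 * \<gamma>) * norm (fst z) powr (2 * \<gamma>)"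

lemma gauge_weight_nonneg [simp]: "0 \<le> gauge_weight \<gamma> \<beta> z"
  by (simp add: gauge_weight_def)

lemma gauge_weight_le:
  assumes "\<gamma> > 0" shows "gauge_weight \<gamma> \<beta> z \<le> gauge \<gamma> z powr \<beta>"
proof -
  have "norm (fst z) powr (2 * \<gamma>) \<le> gauge \<gamma> z powr (2 * \<gamma>)"
    using assms norm_fst_le_gauge[OF assms, of z] by (intro powr_mono2) auto
  then have "gauge_weight \<gamma> \<beta> z \<le> gauge \<gamma> z powr (\<beta> - 2 * \<gamma>) * gauge \<gamma> z powr (2 * \<gamma>)"
    unfolding gauge_weight_def by (intro mult_left_mono) auto
  then show ?thesis by (simp flip: powr_add)
qed

lemma borel_measurable_gauge_weight [measurable]:
  "gauge_weight \<gamma> \<beta> \<in> borel_measurable (borel :: ('a::euclidean_space \<times> 'b::euclidean_space) measure)"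
proof -
  have [measurable]: "(\<lambda>z. norm (fst z)) \<in> borel_measurable (borel :: ('a \<times> 'b) measure)"
    by (intro borel_measurable_continuous_onI continuous_intros)
  show ?thesis unfolding gauge_weight_def[abs_def] by measurable
qed

subsection \<open>Regularisation of the gauge\<close>

text \<open>Replacing \<open>|x|\<^sup>2\<close> by \<open>|x|\<^sup>2 + \<epsilon>\<close> in \<open>\<rho>\<close> to the power \<open>2(1 + \<gamma>)\<close> makes it positive and smooth,
  also where \<open>x = 0\<close>.\<close>
definition reg :: "real \<Rightarrow> real \<Rightarrow> 'a::euclidean_space \<times> 'b::euclidean_space \<Rightarrow> real" where
  "reg \<gamma> \<epsilon> z = (fst z \<bullet> fst z + \<epsilon>) powr (1 + \<gamma>) + (1 + \<gamma>)\<^sup>2 * (snd z \<bullet> snd z)"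

definition reg_deriv :: "real \<Rightarrow> real \<Rightarrow> 'a::euclidean_space \<times> 'b::euclidean_space \<Rightarrow> 'a \<times> 'b \<Rightarrow> real" where
  "reg_deriv \<gamma> \<epsilon> z h =
     2 * (1 + \<gamma>) * ((fst z \<bullet> fst z + \<epsilon>) powr \<gamma> * (fst z \<bullet> fst h) + (1 + \<gamma>) * (snd z \<bullet> snd h))"

lemma reg_pos: "\<epsilon> > 0 \<Longrightarrow> reg \<gamma> \<epsilon> z > 0"
  using inner_ge_zero[of "fst z"] unfolding reg_def
  by (intro add_pos_nonneg) (auto simp: add_nonneg_eq_0_iff)

lemma reg_neq_0: "\<epsilon> > 0 \<Longrightarrow> reg \<gamma> \<epsilon> z \<noteq> 0"
  using reg_pos[of \<epsilon> \<gamma> z] by simp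

lemma reg_0_eq: "\<gamma> > 0 \<Longrightarrow> reg \<gamma> 0 z = gauge \<gamma> z powr (2 * (1 + \<gamma>))"
  by (simp only: reg_def gauge_powr_eq inner_self_powr add_0_right) (simp only: dot_square_norm)

lemma reg_mono: "\<gamma> > 0 \<Longrightarrow> 0 \<le> \<epsilon> \<Longrightarrow> \<epsilon> \<le> \<epsilon>' \<Longrightarrow> reg \<gamma> \<epsilon> z \<le> reg \<gamma> \<epsilon>' z"
  unfolding reg_def by (intro add_mono powr_mono2) auto

lemma reg_has_derivative:
  assumes p: "fst z \<bullet> fst z + \<epsilon> > 0"
  shows "(reg \<gamma> \<epsilon> has_derivative reg_deriv \<gamma> \<epsilon> z) (at z)"
proof -
  have "((\<lambda>z. (fst z \<bullet> fst z + \<epsilon>) powr (1 + \<gamma>) + (1 + \<gamma>)\<^sup>2 * (snd z \<bullet> snd z)) has_derivative reg_deriv \<gamma> \<epsilon> z) (at z)"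
    by (rule has_derivative_eq_rhs, (rule derivative_intros p UNIV_I)+)
      (use p in \<open>auto simp: fun_eq_iff reg_deriv_def powr_add inner_commute field_simps power2_eq_square\<close>)
  then show ?thesis by (simp add: reg_def[abs_def])
qed

lemma continuous_on_reg: "\<epsilon> > 0 \<Longrightarrow> continuous_on S (reg \<gamma> \<epsilon>)"
  unfolding reg_def[abs_def]
  by (intro continuous_intros) (smt (verit) inner_ge_zero)

lemma continuous_on_reg_deriv: "\<epsilon> > 0 \<Longrightarrow> continuous_on S (\<lambda>z. reg_deriv \<gamma> \<epsilon> z h)"
  unfolding reg_deriv_def[abs_def]
  by (intro continuous_intros) (smt (verit) inner_ge_zero)

text \<open>As \<open>reg\<close> increases with \<epsilon>, its power is largest at \<epsilon> = 1
  if b \<ge> 0 and is bounded by its value at \<epsilon> = 0 if b < 0. The sum of both values is a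
  majorant free of \<epsilon> for either sign.\<close>

lemma reg_powr_le:
  assumes "\<gamma> > 0" "0 < \<epsilon>" "\<epsilon> \<le> 1" "z \<noteq> 0"
  shows "reg \<gamma> \<epsilon> z powr b \<le> gauge \<gamma> z powr (2 * (1 + \<gamma>) * b) + reg \<gamma> 1 z powr b"
proof (cases "b \<ge> 0")
  case True
  then have "reg \<gamma> \<epsilon> z powr b \<le> reg \<gamma> 1 z powr b"
    using assms reg_pos[of \<epsilon> \<gamma> z] by (intro powr_mono2 reg_mono) auto
  then show ?thesis by (simp add: add_increasing)
next
  case False
  have "reg \<gamma> 0 z > 0" using assms gauge_pos[of \<gamma> z] by (simp add: reg_0_eq)
  then have "reg \<gamma> \<epsilon> z powr b \<le> reg \<gamma> 0 z powr b"
    using False assms by (intro powr_mono2' reg_mono) auto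
  then show ?thesis using assms by (simp add: reg_0_eq powr_powr add_increasing2)
qed

text \<open>Dominated convergence removes the regularisation. The majorant is integrable because
  \<rho>^\<beta> is locally integrable and \<open>reg \<gamma> 1\<close> is continuous and positive;
  convergence is asked for only off a null set.\<close>

lemma integral_regularized_limit_eq_0:
  fixes h :: "'a::euclidean_space \<times> 'b::euclidean_space \<Rightarrow> real"
  assumes "\<gamma> > 0" "- hom_dim \<gamma> TYPE('a) TYPE('b) < \<beta>"
    and S: "compact S" and h: "continuous_on UNIV h" "\<And>z. z \<notin> S \<Longrightarrow> h z = 0"
    and F: "\<And>n. has_bochner_integral lborel (F n) 0"
    and bound: "\<And>n z. z \<noteq> 0 \<Longrightarrow> \<bar>F n z\<bar> \<le> (gauge \<gamma> z powr \<beta> + reg \<gamma> 1 z powr b) * h z"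
    and L: "L \<in> borel_measurable borel"
    and lim: "\<And>z. fst z \<noteq> 0 \<Longrightarrow> (\<lambda>n. F n z) \<longlonglongrightarrow> L z"
  shows "(\<integral>z. L z \<partial>lborel) = 0"
proof -
  define w where "w z = (gauge \<gamma> z powr \<beta> + reg \<gamma> 1 z powr b) * h z" for z
  have AE: "AE z in (lborel :: ('a \<times> 'b) measure). fst z \<noteq> 0" by (rule AE_fst_neq_0)
  have "integrable lborel (\<lambda>z. gauge \<gamma> z powr \<beta> * h z)"
    using assms by (intro integrable_gauge_weight[OF assms(1,2) S]) auto
  moreover have "integrable lborel (\<lambda>z. reg \<gamma> 1 z powr b * h z)"
    using h
    by (intro integrable_compact_support[OF S] continuous_intros continuous_on_reg ballI)
       (simp_all add: reg_neq_0)
  ultimately have "integrable lborel w"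
    unfolding w_def by (simp add: distrib_right)
  then have "(\<lambda>n. \<integral>z. F n z \<partial>lborel) \<longlonglongrightarrow> (\<integral>z. L z \<partial>lborel)"
  proof (rule integral_dominated_convergence[rotated 2])
    show "AE z in lborel. (\<lambda>n. F n z) \<longlonglongrightarrow> L z" using AE by eventually_elim (rule lim)
    show "AE z in lborel. norm (F n z) \<le> w z" for n
      using AE by eventually_elim (metis bound fst_zero w_def real_norm_def)
    show "F n \<in> borel_measurable lborel" for n
      by (rule borel_measurable_has_bochner_integral[OF F])
  qed (use L in auto)
  then show ?thesis using F by (simp add: has_bochner_integral_iff LIMSEQ_const_iff)
qed

text \<open>Regularised counterpart of \<open>gauge_weight\<close>. The exponent is divided by 2(1 +
  \<gamma>) because \<open>reg\<close> approximates that power of the gauge.\<close>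

definition reg_weight :: "real \<Rightarrow> real \<Rightarrow> real \<Rightarrow> 'a::euclidean_space \<times> 'b::euclidean_space \<Rightarrow> real" where
  "reg_weight \<gamma> \<beta> \<epsilon> z
     = reg \<gamma> \<epsilon> z powr ((\<beta> - 2 * \<gamma>) / (2 * (1 + \<gamma>))) * (fst z \<bullet> fst z + \<epsilon>) powr \<gamma>"

lemma reg_weight_nonneg [simp]: "0 \<le> reg_weight \<gamma> \<beta> \<epsilon> z"
  by (simp add: reg_weight_def)

lemma reg_weight_0_eq: "\<gamma> > 0 \<Longrightarrow> reg_weight \<gamma> \<beta> 0 z = gauge_weight \<gamma> \<beta> z"
  by (simp add: reg_weight_def gauge_weight_def reg_0_eq powr_powr inner_self_powr)

text \<open>The first summand of \<open>reg\<close> bounds the degenerate factor by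
  \<open>reg\<close> to the power \<gamma> / (1 + \<gamma>), and the exponents then add up to the
  one corresponding to \<rho>^\<beta>.\<close>

lemma reg_weight_le:
  assumes "\<gamma> > 0" "\<epsilon> > 0"
  shows "reg_weight \<gamma> \<beta> \<epsilon> z \<le> reg \<gamma> \<epsilon> z powr (\<beta> / (2 * (1 + \<gamma>)))"
proof -
  have "(fst z \<bullet> fst z + \<epsilon>) powr \<gamma> = ((fst z \<bullet> fst z + \<epsilon>) powr (1 + \<gamma>)) powr (\<gamma> / (1 + \<gamma>))"
    using assms by (simp add: powr_powr)
  also have "\<dots> \<le> reg \<gamma> \<epsilon> z powr (\<gamma> / (1 + \<gamma>))"
    using assms by (intro powr_mono2) (auto simp: reg_def)
  finally have "reg_weight \<gamma> \<beta> \<epsilon> z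
      \<le> reg \<gamma> \<epsilon> z powr ((\<beta> - 2 * \<gamma>) / (2 * (1 + \<gamma>))) * reg \<gamma> \<epsilon> z powr (\<gamma> / (1 + \<gamma>))"
    unfolding reg_weight_def by (intro mult_left_mono) auto
  also have "\<dots> = reg \<gamma> \<epsilon> z powr ((\<beta> - 2 * \<gamma>) / (2 * (1 + \<gamma>)) + \<gamma> / (1 + \<gamma>))"
    by (simp add: powr_add)
  also have "(\<beta> - 2 * \<gamma>) / (2 * (1 + \<gamma>)) + \<gamma> / (1 + \<gamma>) = \<beta> / (2 * (1 + \<gamma>))"
    using assms by (simp add: divide_simps) (simp add: algebra_simps)
  finally show ?thesis .
qed

lemma tendsto_reg:
  assumes "fst z \<noteq> 0" "\<epsilon> \<longlonglongrightarrow> 0"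
  shows "(\<lambda>n. reg \<gamma> (\<epsilon> n) z) \<longlonglongrightarrow> reg \<gamma> 0 z"
proof -
  have "(\<lambda>n. fst z \<bullet> fst z + \<epsilon> n) \<longlonglongrightarrow> fst z \<bullet> fst z + 0" by (intro tendsto_intros assms)
  then show ?thesis unfolding reg_def using assms by (intro tendsto_intros) auto
qed

lemma reg_0_pos: "\<gamma> > 0 \<Longrightarrow> fst z \<noteq> 0 \<Longrightarrow> reg \<gamma> 0 z > 0"
  unfolding reg_def by (intro add_pos_nonneg) auto

lemma tendsto_reg_weight:
  assumes "\<gamma> > 0" "fst z \<noteq> 0" "\<epsilon> \<longlonglongrightarrow> 0"
  shows "(\<lambda>n. reg_weight \<gamma> \<beta> (\<epsilon> n) z) \<longlonglongrightarrow> gauge_weight \<gamma> \<beta> z"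
proof -
  have "(\<lambda>n. fst z \<bullet> fst z + \<epsilon> n) \<longlonglongrightarrow> fst z \<bullet> fst z + 0" by (intro tendsto_intros assms)
  then show ?thesis
    unfolding reg_weight_0_eq[OF assms(1), symmetric] unfolding reg_weight_def
    using assms reg_0_pos[of \<gamma> z] by (intro tendsto_intros tendsto_reg) auto
qed

section \<open>Divergence identities with singular weights\<close>

text \<open>The weight is homogeneous of degree \<beta> under the dilations, so its Euler derivative
  is \<beta> times itself and the divergence identity acquires the coefficient \<beta> + Q.
  Regularised weights are inserted and \<epsilon> tends to 0; \<beta> > -Q provides the integrable
  majorant.\<close>

lemma dilation_identity:
  fixes f :: "'a::euclidean_space \<times> 'b::euclidean_space \<Rightarrow> real"
  assumes "\<gamma> > 0" and \<beta>: "- hom_dim \<gamma> TYPE('a) TYPE('b) < \<beta>" and f: "Cinf0 \<Omega> f"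
  shows "(\<integral>z. (\<beta> + hom_dim \<gamma> TYPE('a) TYPE('b)) * (gauge_weight \<gamma> \<beta> z * (f z)\<^sup>2)
      + 2 * (gauge_weight \<gamma> \<beta> z * (f z * euler_deriv \<gamma> f z)) \<partial>lborel) = 0"
proof -
  obtain S where S: "compact S" "\<And>z. z \<notin> S \<Longrightarrow> f z = 0" using Cinf0_support[OF f] by metis
  define Q where "Q = hom_dim \<gamma> TYPE('a) TYPE('b)"
  define E where "E = euler_deriv \<gamma> f"
  have Ec: "continuous_on UNIV E" unfolding E_def by (rule continuous_on_euler_deriv[OF f])
  have fc: "continuous_on UNIV f" by (rule Cinf0_has_derivative(5)[OF f])
  have fm[measurable]: "f \<in> borel_measurable borel" and Em[measurable]: "E \<in> borel_measurable borel"
    using fc Ec by (auto intro: borel_measurable_continuous_onI)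
  define s where "s = (\<beta> - 2 * \<gamma>) / (2 * (1 + \<gamma>))"
  define \<epsilon> where "\<epsilon> n = inverse (real (Suc n))" for n
  have \<epsilon>: "0 < \<epsilon> n" "\<epsilon> n \<le> 1" for n by (auto simp: \<epsilon>_def inverse_le_1_iff)
  have \<epsilon>0: "\<epsilon> \<longlonglongrightarrow> 0" unfolding \<epsilon>_def[abs_def] by (rule LIMSEQ_inverse_real_of_nat)
  define c :: "nat \<Rightarrow> 'a \<times> 'b \<Rightarrow> real" where "c n = reg_weight \<gamma> \<beta> (\<epsilon> n)" for n
  \<comment> \<open>\<open>p n z\<close> is the logarithmic derivative of \<open>c n\<close> at
    \<open>z\<close>; along the dilation field it stays bounded as \<epsilon> tends to 0.\<close>
  define p where "p n z h = s * reg_deriv \<gamma> (\<epsilon> n) z h / reg \<gamma> (\<epsilon> n) z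
      + \<gamma> * (2 * (fst z \<bullet> fst h)) / (fst z \<bullet> fst z + \<epsilon> n)" for n and z h :: "'a \<times> 'b"
  have pos: "fst z \<bullet> fst z + \<epsilon> n > 0" for z :: "'a \<times> 'b" and n
    using \<epsilon>[of n] by (simp add: add_nonneg_pos)
  have der: "(c n has_derivative (\<lambda>h. c n z * p n z h)) (at z)" for n z
  proof -
    have "((\<lambda>z. reg \<gamma> (\<epsilon> n) z powr s * (fst z \<bullet> fst z + \<epsilon> n) powr \<gamma>) has_derivative (\<lambda>h. c n z * p n z h)) (at z)"
      by (rule has_derivative_eq_rhs, (rule derivative_intros reg_has_derivative \<epsilon> reg_pos pos UNIV_I)+)
        (use pos[of z n] reg_pos[OF \<epsilon>(1)[of n], of \<gamma> z] in \<open>auto simp: fun_eq_iff c_def p_def reg_weight_def s_def inner_commute algebra_simps\<close>)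
    then show ?thesis by (simp add: c_def[abs_def] reg_weight_def[abs_def] s_def)
  qed
  have cc: "continuous_on UNIV (c n)" for n
    using der by (meson continuous_at_imp_continuous_on has_derivative_continuous)
  have der_c: "continuous_on UNIV (\<lambda>z. c n z * p n z e)" for n e
    unfolding p_def using pos \<epsilon>(1)
    by (intro continuous_intros cc continuous_on_reg continuous_on_reg_deriv ballI)
      (auto simp: reg_neq_0 less_imp_neq[THEN not_sym])
  define d where "d z = (fst z, (1 + \<gamma>) *\<^sub>R snd z)" for z :: "'a \<times> 'b"
  define F where "F n z = (c n z * p n z (d z) + Q * c n z) * (f z)\<^sup>2 + 2 * c n z * f z * E z" for n z
  have F: "has_bochner_integral lborel (F n) 0" for n
    unfolding F_def Q_def d_def E_def by (rule dilation_divergence_identity[OF f der der_c])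
  define K where "K = 2 * (1 + \<gamma>) * \<bar>s\<bar> + 2 * \<gamma> + Q"
  have Q0: "Q > 0" using hom_dim_gt_2[OF assms(1), where 'a='a and 'b='b] by (simp add: Q_def)
  have pd: "p n z (d z) = s * (2 * (1 + \<gamma>) * ((fst z \<bullet> fst z + \<epsilon> n) powr \<gamma> * (fst z \<bullet> fst z) + (1 + \<gamma>)\<^sup>2 * (snd z \<bullet> snd z)) / reg \<gamma> (\<epsilon> n) z)
      + \<gamma> * (2 * (fst z \<bullet> fst z)) / (fst z \<bullet> fst z + \<epsilon> n)" for n z
    by (simp add: p_def d_def reg_deriv_def power2_eq_square)
  \<comment> \<open>The bound is uniform in \<open>n\<close>: replacing a factor |x|^2 by |x|^2 +
    \<epsilon> shows that \<open>u\<close> is at most \<open>reg\<close>, and the other quotient is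
    at most 1.\<close>
  have pb: "\<bar>p n z (d z)\<bar> \<le> 2 * (1 + \<gamma>) * \<bar>s\<bar> + 2 * \<gamma>" for n z
  proof -
    define u where "u = (fst z \<bullet> fst z + \<epsilon> n) powr \<gamma> * (fst z \<bullet> fst z) + (1 + \<gamma>)\<^sup>2 * (snd z \<bullet> snd z)"
    have "0 \<le> u" by (simp add: u_def)
    have "(fst z \<bullet> fst z + \<epsilon> n) powr \<gamma> * (fst z \<bullet> fst z) \<le> (fst z \<bullet> fst z + \<epsilon> n) powr \<gamma> * (fst z \<bullet> fst z + \<epsilon> n)"
      using \<epsilon>(1)[of n] by (intro mult_left_mono) auto
    also have "\<dots> = (fst z \<bullet> fst z + \<epsilon> n) powr (1 + \<gamma>)"
      using pos[of z n] by (simp add: powr_add mult.commute)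
    finally have "u \<le> reg \<gamma> (\<epsilon> n) z" by (simp add: u_def reg_def)
    then have "u / reg \<gamma> (\<epsilon> n) z \<le> 1" using reg_pos[OF \<epsilon>(1), of \<gamma> n z] by simp
    then have "\<bar>s\<bar> * (2 * (1 + \<gamma>) * (u / reg \<gamma> (\<epsilon> n) z)) \<le> \<bar>s\<bar> * (2 * (1 + \<gamma>) * 1)"
      using assms(1) by (intro mult_left_mono) auto
    moreover have "\<bar>s * (2 * (1 + \<gamma>) * u / reg \<gamma> (\<epsilon> n) z)\<bar> = \<bar>s\<bar> * (2 * (1 + \<gamma>) * (u / reg \<gamma> (\<epsilon> n) z))"
      using \<open>0 \<le> u\<close> assms(1) reg_pos[OF \<epsilon>(1), of \<gamma> n z] by (simp add: abs_mult)
    ultimately have 1: "\<bar>s * (2 * (1 + \<gamma>) * u / reg \<gamma> (\<epsilon> n) z)\<bar> \<le> \<bar>s\<bar> * (2 * (1 + \<gamma>) * 1)" by simp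
    have "(fst z \<bullet> fst z) / (fst z \<bullet> fst z + \<epsilon> n) \<le> 1"
      using pos[of z n] \<epsilon>(1)[of n] by simp
    then have 2: "\<bar>\<gamma> * (2 * (fst z \<bullet> fst z)) / (fst z \<bullet> fst z + \<epsilon> n)\<bar> \<le> \<gamma> * 2"
      using assms(1) pos[of z n] mult_left_mono[of "(fst z \<bullet> fst z) / (fst z \<bullet> fst z + \<epsilon> n)" 1 "2 * \<gamma>"]
      by (simp add: abs_mult algebra_simps)
    show ?thesis unfolding pd u_def[symmetric] using 1 2
      by (intro order_trans[OF abs_triangle_ineq]) (simp add: algebra_simps)
  qed
  define L where "L z = (\<beta> + Q) * (gauge_weight \<gamma> \<beta> z * (f z)\<^sup>2) + 2 * (gauge_weight \<gamma> \<beta> z * (f z * E z))" for z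
  have "(\<integral>z. L z \<partial>lborel) = 0"
  proof (rule integral_regularized_limit_eq_0[OF assms(1) \<beta> S(1), where F=F and b="\<beta> / (2 * (1 + \<gamma>))"
        and h="\<lambda>z. K * (f z)\<^sup>2 + 2 * \<bar>f z\<bar> * \<bar>E z\<bar>"])
    show "continuous_on UNIV (\<lambda>z. K * (f z)\<^sup>2 + 2 * \<bar>f z\<bar> * \<bar>E z\<bar>)" by (intro continuous_intros fc Ec)
    show "K * (f z)\<^sup>2 + 2 * \<bar>f z\<bar> * \<bar>E z\<bar> = 0" if "z \<notin> S" for z using S(2)[OF that] by simp
    show "L \<in> borel_measurable borel" unfolding L_def[abs_def] by measurable
    show "\<bar>F n z\<bar> \<le> (gauge \<gamma> z powr \<beta> + reg \<gamma> 1 z powr (\<beta> / (2 * (1 + \<gamma>)))) * (K * (f z)\<^sup>2 + 2 * \<bar>f z\<bar> * \<bar>E z\<bar>)"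
      if "z \<noteq> 0" for n z
    proof -
      have "F n z = c n z * ((p n z (d z) + Q) * (f z)\<^sup>2 + 2 * f z * E z)" by (simp add: F_def algebra_simps)
      also have "\<bar>\<dots>\<bar> \<le> c n z * (K * (f z)\<^sup>2 + 2 * \<bar>f z\<bar> * \<bar>E z\<bar>)"
      proof -
        have "\<bar>(p n z (d z) + Q) * (f z)\<^sup>2\<bar> \<le> K * (f z)\<^sup>2"
          unfolding abs_mult using pb[of n z] Q0 by (intro mult_mono) (auto simp: K_def)
        then have "\<bar>(p n z (d z) + Q) * (f z)\<^sup>2 + 2 * f z * E z\<bar> \<le> K * (f z)\<^sup>2 + 2 * \<bar>f z\<bar> * \<bar>E z\<bar>"
          by (intro order_trans[OF abs_triangle_ineq] add_mono) (auto simp: abs_mult)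
        then show ?thesis unfolding abs_mult by (intro mult_mono) (auto simp: c_def)
      qed
      also have "c n z \<le> gauge \<gamma> z powr \<beta> + reg \<gamma> 1 z powr (\<beta> / (2 * (1 + \<gamma>)))"
      proof -
        have "c n z \<le> reg \<gamma> (\<epsilon> n) z powr (\<beta> / (2 * (1 + \<gamma>)))"
          unfolding c_def by (intro reg_weight_le assms \<epsilon>)
        also have "\<dots> \<le> gauge \<gamma> z powr (2 * (1 + \<gamma>) * (\<beta> / (2 * (1 + \<gamma>)))) + reg \<gamma> 1 z powr (\<beta> / (2 * (1 + \<gamma>)))"
          by (intro reg_powr_le assms \<epsilon> that)
        finally show ?thesis using assms(1) by simp
      qed
      finally show ?thesis using Q0 assms(1) by (simp add: K_def mult_right_mono)
    qed
    show "(\<lambda>n. F n z) \<longlonglongrightarrow> L z" if z: "fst z \<noteq> 0" for z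
    proof -
      have c: "(\<lambda>n. c n z) \<longlonglongrightarrow> gauge_weight \<gamma> \<beta> z"
        unfolding c_def by (intro tendsto_reg_weight assms z \<epsilon>0)
      have e: "(\<lambda>n. fst z \<bullet> fst z + \<epsilon> n) \<longlonglongrightarrow> fst z \<bullet> fst z" using tendsto_add[OF tendsto_const \<epsilon>0] by auto
      have "(\<lambda>n. p n z (d z)) \<longlonglongrightarrow> s * (2 * (1 + \<gamma>) * ((fst z \<bullet> fst z) powr \<gamma> * (fst z \<bullet> fst z) + (1 + \<gamma>)\<^sup>2 * (snd z \<bullet> snd z)) / reg \<gamma> 0 z)
         + \<gamma> * (2 * (fst z \<bullet> fst z)) / (fst z \<bullet> fst z)" (is "_ \<longlonglongrightarrow> ?l")
        unfolding pd using z reg_0_pos[OF assms(1) z] by (intro tendsto_intros e tendsto_reg \<epsilon>0) auto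
      also have "(fst z \<bullet> fst z) powr \<gamma> * (fst z \<bullet> fst z) + (1 + \<gamma>)\<^sup>2 * (snd z \<bullet> snd z) = reg \<gamma> 0 z"
        using z by (simp add: reg_def powr_add mult.commute)
      \<comment> \<open>Here 2(1 + \<gamma>)s = \<beta> - 2\<gamma>, and the second term contributes
        the missing 2\<gamma>.\<close>
      also have "s * (2 * (1 + \<gamma>) * reg \<gamma> 0 z / reg \<gamma> 0 z) + \<gamma> * (2 * (fst z \<bullet> fst z)) / (fst z \<bullet> fst z) = \<beta>"
        using z reg_0_pos[OF assms(1) z] assms(1) by (simp add: s_def)
      finally have "(\<lambda>n. p n z (d z)) \<longlonglongrightarrow> \<beta>" .
      then have "(\<lambda>n. F n z) \<longlonglongrightarrow> (gauge_weight \<gamma> \<beta> z * \<beta> + Q * gauge_weight \<gamma> \<beta> z) * (f z)\<^sup>2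
          + 2 * gauge_weight \<gamma> \<beta> z * f z * E z"
        unfolding F_def by (intro tendsto_intros c)
      then show ?thesis by (simp add: L_def algebra_simps)
    qed
  qed (rule F)
  then show ?thesis by (simp add: L_def E_def Q_def)
qed

text \<open>Green's identity with \<open>v\<close> equal to \<rho>^(\<alpha>-2): its horizontal
  gradient paired with that of \<open>f\<close> is \<alpha> - 2 times
  \<open>gauge_weight \<gamma> (\<alpha> - 4)\<close> times the Euler derivative. A power of
  \<open>reg\<close> approximates \<open>v\<close>.\<close>

lemma rellich_green_identity:
  fixes f :: "'a::euclidean_space \<times> 'b::euclidean_space \<Rightarrow> real"
  assumes "\<gamma> > 0" "\<alpha> > 2" and f: "Cinf0 \<Omega> f"
  shows "(\<integral>z. gauge \<gamma> z powr (\<alpha> - 2) * (f z * grushin_laplacian \<gamma> f z)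
      + gauge \<gamma> z powr (\<alpha> - 2) * grad_gamma_sq \<gamma> f z
      + (\<alpha> - 2) * (gauge_weight \<gamma> (\<alpha> - 4) z * (f z * euler_deriv \<gamma> f z)) \<partial>lborel) = 0"
proof -
  obtain S where S: "compact S" "\<And>z. z \<notin> S \<Longrightarrow> f z = 0"
    "\<And>z. z \<notin> S \<Longrightarrow> frechet_derivative f (at z) = (\<lambda>_. 0)" using Cinf0_support[OF f] by metis
  define X where "X z = (\<Sum>e\<in>Basis. (fst z \<bullet> e) * frechet_derivative f (at z) (e, 0))" for z
  define Y where "Y z = (1 + \<gamma>) * (\<Sum>e\<in>Basis. (snd z \<bullet> e) * frechet_derivative f (at z) (0, e))" for z
  define Lf where "Lf = grushin_laplacian \<gamma> f"
  define G where "G = grad_gamma_sq \<gamma> f"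
  have XY: "euler_deriv \<gamma> f z = X z + Y z" for z
    unfolding euler_deriv_def X_def Y_def
    by (subst linear_fst_snd_expansion[OF has_derivative_linear[OF Cinf0_has_derivative(1)[OF f]]])
      (simp add: sum_distrib_left mult.assoc)
  have Xc: "continuous_on UNIV X" and Yc: "continuous_on UNIV Y"
    unfolding X_def[abs_def] Y_def[abs_def]
    by (intro continuous_intros Cinf0_has_derivative(3)[OF f]; auto simp: Basis_prod_def)+
  have fc: "continuous_on UNIV f" by (rule Cinf0_has_derivative(5)[OF f])
  have Lc: "continuous_on UNIV Lf" unfolding Lf_def by (rule continuous_on_grushin_laplacian[OF f assms(1)])
  have Gc: "continuous_on UNIV G" unfolding G_def by (rule continuous_on_grad_gamma_sq[OF f assms(1)])
  have [measurable]: "f \<in> borel_measurable borel" "X \<in> borel_measurable borel" "Y \<in> borel_measurable borel"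
    "Lf \<in> borel_measurable borel" "G \<in> borel_measurable borel"
    using fc Xc Yc Lc Gc by (auto intro: borel_measurable_continuous_onI)
  define \<beta> where "\<beta> = \<alpha> - 4"
  have \<beta>: "- hom_dim \<gamma> TYPE('a) TYPE('b) < \<beta>"
    using hom_dim_gt_2[OF assms(1), where 'a='a and 'b='b] assms(2) by (simp add: \<beta>_def)
  define b where "b = \<beta> / (2 * (1 + \<gamma>))"
  \<comment> \<open>\<open>reg\<close> to the power \<tau> approximates \<rho>^(\<alpha>-2);
    differentiation lowers the exponent to \<tau> - 1, the one that \<open>reg_weight\<close> has
    for \<beta> = \<alpha> - 4.\<close>
  define \<tau> where "\<tau> = (\<alpha> - 2) / (2 * (1 + \<gamma>))"
  have \<tau>0: "\<tau> > 0" using assms by (simp add: \<tau>_def)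
  have \<tau>2: "2 * (1 + \<gamma>) * \<tau> = \<alpha> - 2" using assms(1) by (simp add: \<tau>_def)
  have \<tau>1: "\<tau> - 1 = (\<beta> - 2 * \<gamma>) / (2 * (1 + \<gamma>))"
    using assms(1) by (simp add: \<tau>_def \<beta>_def divide_simps)
  define \<epsilon> where "\<epsilon> n = inverse (real (Suc n))" for n
  have \<epsilon>: "0 < \<epsilon> n" "\<epsilon> n \<le> 1" for n by (auto simp: \<epsilon>_def inverse_le_1_iff)
  have \<epsilon>0: "\<epsilon> \<longlonglongrightarrow> 0" unfolding \<epsilon>_def[abs_def] by (rule LIMSEQ_inverse_real_of_nat)
  define v :: "nat \<Rightarrow> 'a \<times> 'b \<Rightarrow> real" where "v n z = reg \<gamma> (\<epsilon> n) z powr \<tau>" for n z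
  define v' where "v' n z h = reg \<gamma> (\<epsilon> n) z powr (\<tau> - 1) * (\<tau> * reg_deriv \<gamma> (\<epsilon> n) z h)" for n and z h :: "'a \<times> 'b"
  have pos: "fst z \<bullet> fst z + \<epsilon> n > 0" for z :: "'a \<times> 'b" and n
    using \<epsilon>[of n] by (simp add: add_nonneg_pos)
  have der: "(v n has_derivative v' n z) (at z)" for n z
  proof -
    have "((\<lambda>z. reg \<gamma> (\<epsilon> n) z powr \<tau>) has_derivative v' n z) (at z)"
      by (rule has_derivative_eq_rhs, (rule derivative_intros reg_has_derivative pos \<epsilon> reg_pos UNIV_I)+)
        (use reg_pos[OF \<epsilon>(1)[of n], of \<gamma> z] in \<open>auto simp: fun_eq_iff v'_def powr_diff field_simps\<close>)
    then show ?thesis by (simp add: v_def[abs_def])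
  qed
  have der_c: "continuous_on UNIV (\<lambda>z. v' n z e)" for n e
    unfolding v'_def using \<epsilon>(1)
    by (intro continuous_intros continuous_on_reg continuous_on_reg_deriv ballI) (auto simp: reg_neq_0)
  \<comment> \<open>Differentiating \<open>reg\<close> yields (|x|^2 + \<epsilon>)^\<gamma> in the x
    part, whereas the operator contributes the exact |x|^(2\<gamma>) in the y part. The two parts of
    the Euler derivative thus carry different weights until the limit is taken, which is why
    \<open>X\<close> and \<open>Y\<close> are kept apart.\<close>
  define W where "W n z = reg_weight \<gamma> \<beta> (\<epsilon> n) z * X z
      + reg \<gamma> (\<epsilon> n) z powr (\<tau> - 1) * (fst z \<bullet> fst z) powr \<gamma> * Y z" for n z
  define F where "F n z = v n z * (f z * Lf z) + v n z * G z + (\<alpha> - 2) * (f z * W n z)" for n z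
  have F: "has_bochner_integral lborel (F n) 0" for n
  proof -
    have "(\<Sum>e\<in>Basis. v' n z (e, 0) * frechet_derivative f (at z) (e, 0))
        + norm (fst z) powr (2 * \<gamma>) * (\<Sum>e\<in>Basis. v' n z (0, e) * frechet_derivative f (at z) (0, e)) = (\<alpha> - 2) * W n z" for z
    proof -
      have "(\<Sum>e\<in>Basis. v' n z (e, 0) * frechet_derivative f (at z) (e, 0))
          = (2 * (1 + \<gamma>) * \<tau>) * (reg \<gamma> (\<epsilon> n) z powr (\<tau> - 1) * (fst z \<bullet> fst z + \<epsilon> n) powr \<gamma> * X z)"
        unfolding X_def sum_distrib_left by (intro sum.cong) (simp_all add: v'_def reg_deriv_def)
      moreover have "(\<Sum>e\<in>Basis. v' n z (0, e) * frechet_derivative f (at z) (0, e))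
          = (2 * (1 + \<gamma>) * \<tau>) * (reg \<gamma> (\<epsilon> n) z powr (\<tau> - 1) * Y z)"
        unfolding Y_def sum_distrib_left by (intro sum.cong) (simp_all add: v'_def reg_deriv_def)
      moreover have "W n z = reg \<gamma> (\<epsilon> n) z powr (\<tau> - 1) * (fst z \<bullet> fst z + \<epsilon> n) powr \<gamma> * X z
          + norm (fst z) powr (2 * \<gamma>) * (reg \<gamma> (\<epsilon> n) z powr (\<tau> - 1) * Y z)"
        by (simp add: W_def reg_weight_def \<tau>1 inner_self_powr)
      ultimately show ?thesis unfolding \<tau>2 by (simp only:) (simp only: distrib_left mult.left_commute)
    qed
    then show ?thesis
      using grushin_green_identity[OF f assms(1) der der_c, of n]
      by (simp add: F_def[abs_def] Lf_def G_def ac_simps)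
  qed
  define L where "L z = gauge \<gamma> z powr (\<alpha> - 2) * (f z * Lf z) + gauge \<gamma> z powr (\<alpha> - 2) * G z
      + (\<alpha> - 2) * (gauge_weight \<gamma> \<beta> z * (f z * (X z + Y z)))" for z
  \<comment> \<open>\<open>v n\<close> is bounded by \<open>reg \<gamma> 1\<close> to the power
    \<tau>, but the majorant offers only the power \<open>b\<close>; the continuous factor with
    exponent \<tau> - b makes up the difference.\<close>
  define h where "h z = reg \<gamma> 1 z powr (\<tau> - b) * (\<bar>f z * Lf z\<bar> + \<bar>G z\<bar>) + (\<alpha> - 2) * (\<bar>f z\<bar> * (\<bar>X z\<bar> + \<bar>Y z\<bar>))" for z
  have r1: "reg \<gamma> 1 z > 0" for z :: "'a \<times> 'b" by (rule reg_pos) simp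
  have "(\<integral>z. L z \<partial>lborel) = 0"
  proof (rule integral_regularized_limit_eq_0[OF assms(1) \<beta> S(1), where F=F and b=b and h=h])
    show "continuous_on UNIV h"
      unfolding h_def using r1
      by (intro continuous_intros fc Xc Yc Lc Gc continuous_on_reg ballI) (auto simp: reg_neq_0)
    show "h z = 0" if "z \<notin> S" for z using S(2,3)[OF that] by (simp add: h_def G_def grad_gamma_sq_def)
    show "L \<in> borel_measurable borel" unfolding L_def[abs_def] by measurable
    show "\<bar>F n z\<bar> \<le> (gauge \<gamma> z powr \<beta> + reg \<gamma> 1 z powr b) * h z" if "z \<noteq> 0" for n z
    proof -
      let ?B = "gauge \<gamma> z powr \<beta> + reg \<gamma> 1 z powr b"
      have v: "v n z \<le> reg \<gamma> 1 z powr b * reg \<gamma> 1 z powr (\<tau> - b)"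
        unfolding v_def powr_add[symmetric] using \<tau>0 \<epsilon> assms(1) reg_pos[OF \<epsilon>(1), of \<gamma> n z]
        by (simp, intro powr_mono2 reg_mono) (auto intro: less_imp_le)
      also have "\<dots> \<le> ?B * reg \<gamma> 1 z powr (\<tau> - b)" by (intro mult_right_mono) auto
      finally have v: "v n z \<le> ?B * reg \<gamma> 1 z powr (\<tau> - b)" .
      have B: "reg \<gamma> (\<epsilon> n) z powr b \<le> ?B"
        using reg_powr_le[OF assms(1) \<epsilon>(1) \<epsilon>(2) that, of n b] assms(1) by (simp add: b_def)
      have w1: "reg_weight \<gamma> \<beta> (\<epsilon> n) z \<le> ?B"
        using reg_weight_le[OF assms(1) \<epsilon>(1), of \<beta> n z] B by (simp add: b_def)
      have "reg \<gamma> (\<epsilon> n) z powr (\<tau> - 1) * (fst z \<bullet> fst z) powr \<gamma> \<le> reg_weight \<gamma> \<beta> (\<epsilon> n) z"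
        unfolding reg_weight_def \<tau>1 using \<epsilon>(1)[of n] assms(1) by (intro mult_left_mono powr_mono2) auto
      then have w2: "reg \<gamma> (\<epsilon> n) z powr (\<tau> - 1) * (fst z \<bullet> fst z) powr \<gamma> \<le> ?B" using w1 by linarith
      have W: "\<bar>W n z\<bar> \<le> ?B * (\<bar>X z\<bar> + \<bar>Y z\<bar>)"
        unfolding W_def distrib_left using w1 w2
        by (intro order_trans[OF abs_triangle_ineq] add_mono) (simp_all add: abs_mult mult_right_mono)
      have "\<bar>F n z\<bar> \<le> v n z * (\<bar>f z * Lf z\<bar> + \<bar>G z\<bar>) + (\<alpha> - 2) * (\<bar>f z\<bar> * \<bar>W n z\<bar>)"
        unfolding F_def distrib_left
        by (intro order_trans[OF abs_triangle_ineq] add_mono) (use assms(2) in \<open>simp_all add: abs_mult v_def\<close>)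
      also have "\<dots> \<le> (?B * reg \<gamma> 1 z powr (\<tau> - b)) * (\<bar>f z * Lf z\<bar> + \<bar>G z\<bar>)
          + (\<alpha> - 2) * (\<bar>f z\<bar> * (?B * (\<bar>X z\<bar> + \<bar>Y z\<bar>)))"
        using assms(2) by (intro add_mono mult_right_mono mult_left_mono v W) auto
      also have "\<dots> = ?B * h z" by (simp add: h_def algebra_simps)
      finally show ?thesis .
    qed
    show "(\<lambda>n. F n z) \<longlonglongrightarrow> L z" if z: "fst z \<noteq> 0" for z
    proof -
      have p: "reg \<gamma> 0 z > 0" by (rule reg_0_pos[OF assms(1) z])
      have v: "(\<lambda>n. v n z) \<longlonglongrightarrow> reg \<gamma> 0 z powr \<tau>"
        unfolding v_def using p by (intro tendsto_intros tendsto_reg z \<epsilon>0) auto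
      have W: "(\<lambda>n. W n z) \<longlonglongrightarrow> gauge_weight \<gamma> \<beta> z * X z + reg \<gamma> 0 z powr (\<tau> - 1) * (fst z \<bullet> fst z) powr \<gamma> * Y z"
        unfolding W_def using p by (intro tendsto_intros tendsto_reg tendsto_reg_weight assms z \<epsilon>0) auto
      have "reg \<gamma> 0 z powr (\<tau> - 1) * (fst z \<bullet> fst z) powr \<gamma> = gauge_weight \<gamma> \<beta> z"
        using reg_weight_0_eq[OF assms(1), of \<beta> z] by (simp add: reg_weight_def \<tau>1)
      moreover have "reg \<gamma> 0 z powr \<tau> = gauge \<gamma> z powr (\<alpha> - 2)"
        using \<tau>2 by (simp add: reg_0_eq[OF assms(1)] powr_powr)
      ultimately have "(\<lambda>n. F n z) \<longlonglongrightarrow> gauge \<gamma> z powr (\<alpha> - 2) * (f z * Lf z) + gauge \<gamma> z powr (\<alpha> - 2) * G z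
          + (\<alpha> - 2) * (f z * (gauge_weight \<gamma> \<beta> z * X z + gauge_weight \<gamma> \<beta> z * Y z))"
        unfolding F_def using v W by (intro tendsto_intros) auto
      then show ?thesis by (simp add: L_def algebra_simps)
    qed
  qed (rule F)
  then show ?thesis by (simp add: L_def Lf_def G_def XY \<beta>_def)
qed

subsection \<open>The horizontal gradient of the gauge\<close>

lemma grad_gamma_sq_nonneg [simp]: "0 \<le> grad_gamma_sq \<gamma> f z"
  by (simp add: grad_gamma_sq_def sum_nonneg)

lemma grad_gamma_norm_sq: "(grad_gamma_norm \<gamma> f z)\<^sup>2 = grad_gamma_sq \<gamma> f z"
  by (simp add: grad_gamma_norm_def)

text \<open>Chain rule through \<open>reg \<gamma> 0\<close>, which is \<rho>^(2(1+\<gamma>)) and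
  differentiable where x is nonzero: the squared components recombine into
  \<open>reg \<gamma> 0\<close> itself, and the powers of \<rho> collapse to -2\<gamma>.\<close>

lemma grad_gamma_sq_gauge:
  fixes z :: "'a::euclidean_space \<times> 'b::euclidean_space"
  assumes "\<gamma> > 0" and z: "fst z \<noteq> 0"
  shows "grad_gamma_sq \<gamma> (gauge \<gamma>) z = norm (fst z) powr (2 * \<gamma>) / gauge \<gamma> z powr (2 * \<gamma>)"
proof -
  have eq: "gauge \<gamma> = (\<lambda>z :: 'a \<times> 'b. reg \<gamma> 0 z powr (1 / (2 * (1 + \<gamma>))))"
    using assms(1) by (simp add: fun_eq_iff reg_0_eq powr_powr)
  have p: "fst z \<bullet> fst z + 0 > 0" "reg \<gamma> 0 z > 0" using z reg_0_pos[OF assms] by auto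
  define g r where "g = gauge \<gamma> z" and "r = reg \<gamma> 0 z"
  have "z \<noteq> 0" using z by (metis fst_zero)
  then have g: "g > 0" using gauge_pos[OF assms(1)] by (simp add: g_def)
  have r: "r > 0" "r = g powr (2 * (1 + \<gamma>))" using p by (auto simp: g_def r_def reg_0_eq[OF assms(1)])
  have "((\<lambda>z. reg \<gamma> 0 z powr (1 / (2 * (1 + \<gamma>)))) has_derivative
      (\<lambda>h. g * (reg_deriv \<gamma> 0 z h * (1 / (2 * (1 + \<gamma>))) / r))) (at z)"
    by (rule has_derivative_eq_rhs, (rule derivative_intros reg_has_derivative p UNIV_I)+)
      (use p assms(1) in \<open>simp add: fun_eq_iff g_def r_def eq\<close>)
  then have "(gauge \<gamma> has_derivative (\<lambda>h. g * (reg_deriv \<gamma> 0 z h * (1 / (2 * (1 + \<gamma>))) / r))) (at z)"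
    by (simp only: eq[symmetric])
  then have D: "frechet_derivative (gauge \<gamma>) (at z) = (\<lambda>h. g * (reg_deriv \<gamma> 0 z h * (1 / (2 * (1 + \<gamma>))) / r))"
    by (rule frechet_derivative_at[symmetric])
  define n where "n = norm (fst z) powr (2 * \<gamma>)"
  have Dx: "frechet_derivative (gauge \<gamma>) (at z) (e, 0) = g / r * n * (fst z \<bullet> e)" for e
    unfolding D reg_deriv_def using assms(1) by (simp add: inner_self_powr n_def)
  have Dy: "frechet_derivative (gauge \<gamma>) (at z) (0, e) = g / r * (1 + \<gamma>) * (snd z \<bullet> e)" for e
    unfolding D reg_deriv_def using assms(1) by (simp add: inner_self_powr)
  have "grad_gamma_sq \<gamma> (gauge \<gamma>) z = (g / r)\<^sup>2 * n * (n * (fst z \<bullet> fst z) + (1 + \<gamma>)\<^sup>2 * (snd z \<bullet> snd z))"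
    unfolding grad_gamma_sq_def Dx Dy power_mult_distrib sum_distrib_left[symmetric] norm_powr_sq n_def[symmetric]
    by (simp add: euclidean_inner[of "fst z" "fst z"] euclidean_inner[of "snd z" "snd z"] flip: power2_eq_square)
      (simp add: power2_eq_square algebra_simps)
  also have "n * (fst z \<bullet> fst z) + (1 + \<gamma>)\<^sup>2 * (snd z \<bullet> snd z) = r"
    using z by (simp add: r_def reg_def n_def powr_add mult.commute inner_self_powr)
  also have "(g / r)\<^sup>2 * n * r = n * (g\<^sup>2 / r)"
    using r(1) by (simp add: power2_eq_square)
  also have "g\<^sup>2 / r = 1 / g powr (2 * \<gamma>)"
    using g by (simp add: r(2) distrib_left powr_add)
  finally show ?thesis by (simp add: n_def g_def)
qed

text \<open>Cauchy-Schwarz for \<open>(|x|^\<gamma> x, (1 + \<gamma>) y)\<close> and the horizontal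
  gradient of \<open>f\<close>: their inner product is |x|^\<gamma> times the Euler derivative, and
  the first vector has squared length \<rho>^(2(1+\<gamma>)). No gradient of the gauge is formed, so
  x = 0 is covered.\<close>

lemma gauge_weight_euler_deriv_le:
  fixes f :: "'a::euclidean_space \<times> 'b::euclidean_space \<Rightarrow> real"
  assumes "\<gamma> > 0" and f: "Cinf0 \<Omega> f"
  shows "gauge_weight \<gamma> \<beta> z * (euler_deriv \<gamma> f z)\<^sup>2 \<le> gauge \<gamma> z powr (\<beta> + 2) * grad_gamma_sq \<gamma> f z"
proof -
  define x y where "x = fst z" and "y = snd z"
  define D where "D = frechet_derivative f (at z)"
  define u :: 'a where "u = (\<Sum>e\<in>Basis. D (e, 0) *\<^sub>R e)"
  define v :: 'b where "v = (\<Sum>e\<in>Basis. D (0, e) *\<^sub>R e)"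
  define n where "n = norm x powr \<gamma>"
  have n2: "n\<^sup>2 = norm x powr (2 * \<gamma>)" by (simp add: n_def norm_powr_sq)
  have "linear D" unfolding D_def by (rule has_derivative_linear[OF Cinf0_has_derivative(1)[OF f]])
  then have "D (x, (1 + \<gamma>) *\<^sub>R y) = (\<Sum>e\<in>Basis. (x \<bullet> e) * D (e, 0)) + (\<Sum>e\<in>Basis. ((1 + \<gamma>) *\<^sub>R y \<bullet> e) * D (0, e))"
    by (rule linear_fst_snd_expansion)
  also have "\<dots> = x \<bullet> u + (1 + \<gamma>) *\<^sub>R y \<bullet> v"
    unfolding euclidean_inner[of x u] euclidean_inner[of _ v] by (simp add: u_def v_def)
  finally have "euler_deriv \<gamma> f z = x \<bullet> u + (1 + \<gamma>) *\<^sub>R y \<bullet> v" by (simp add: euler_deriv_def D_def x_def y_def)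
  then have "n * euler_deriv \<gamma> f z = (n *\<^sub>R x, (1 + \<gamma>) *\<^sub>R y) \<bullet> (u, n *\<^sub>R v)"
    by (simp add: algebra_simps)
  then have "n\<^sup>2 * (euler_deriv \<gamma> f z)\<^sup>2
      \<le> ((n *\<^sub>R x, (1 + \<gamma>) *\<^sub>R y) \<bullet> (n *\<^sub>R x, (1 + \<gamma>) *\<^sub>R y)) * ((u, n *\<^sub>R v) \<bullet> (u, n *\<^sub>R v))"
    unfolding power_mult_distrib[symmetric] by (simp only: Cauchy_Schwarz_ineq)
  also have "(u, n *\<^sub>R v) \<bullet> (u, n *\<^sub>R v) = grad_gamma_sq \<gamma> f z"
  proof -
    have "u \<bullet> u = (\<Sum>e\<in>Basis. (D (e, 0))\<^sup>2)" "v \<bullet> v = (\<Sum>e\<in>Basis. (D (0, e))\<^sup>2)"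
      unfolding euclidean_inner[of u u] euclidean_inner[of v v] by (simp_all add: u_def v_def power2_eq_square)
    then show ?thesis by (simp add: grad_gamma_sq_def D_def n_def x_def power2_eq_square)
  qed
  also have "(n *\<^sub>R x, (1 + \<gamma>) *\<^sub>R y) \<bullet> (n *\<^sub>R x, (1 + \<gamma>) *\<^sub>R y) = n\<^sup>2 * (x \<bullet> x) + (1 + \<gamma>)\<^sup>2 * (y \<bullet> y)"
    by (simp add: power2_eq_square)
  also have "\<dots> = gauge \<gamma> z powr (2 * (1 + \<gamma>))"
    unfolding n2 reg_0_eq[OF assms(1), symmetric]
    by (cases "x = 0") (simp_all add: reg_def powr_add x_def y_def mult.commute inner_self_powr)
  finally have "norm x powr (2 * \<gamma>) * (euler_deriv \<gamma> f z)\<^sup>2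
      \<le> gauge \<gamma> z powr (2 * (1 + \<gamma>)) * grad_gamma_sq \<gamma> f z" by (simp only: n2)
  then have "gauge \<gamma> z powr (\<beta> - 2 * \<gamma>) * (norm x powr (2 * \<gamma>) * (euler_deriv \<gamma> f z)\<^sup>2)
      \<le> gauge \<gamma> z powr (\<beta> - 2 * \<gamma>) * (gauge \<gamma> z powr (2 * (1 + \<gamma>)) * grad_gamma_sq \<gamma> f z)"
    by (intro mult_left_mono) auto
  also have "\<dots> = (gauge \<gamma> z powr (\<beta> - 2 * \<gamma>) * gauge \<gamma> z powr (2 * (1 + \<gamma>))) * grad_gamma_sq \<gamma> f z" by simp
  also have "gauge \<gamma> z powr (\<beta> - 2 * \<gamma>) * gauge \<gamma> z powr (2 * (1 + \<gamma>)) = gauge \<gamma> z powr (\<beta> + 2)"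
    unfolding powr_add[symmetric] by (simp add: algebra_simps)
  finally show ?thesis by (simp add: gauge_weight_def x_def mult.assoc)
qed

text \<open>The first bracket is \<open>|\<nabla>\<^sub>\<gamma>f + H f \<nabla>\<^sub>\<gamma>\<rho> / \<rho>|\<^sup>2\<close> up to a weight; the second one, multiplied by \<open>\<rho>\<^sup>\<delta>\<close>,
  integrates to zero by \<open>dilation_identity\<close>.\<close>
lemma hardy_quadratic_form_le:
  fixes b w \<zeta> \<phi> H \<delta> :: real
  assumes "\<delta> > 0" "w \<ge> 0" "w * \<zeta>\<^sup>2 \<le> b"
  shows "b \<le> (2 + 8 * H\<^sup>2 / \<delta>\<^sup>2) * (b + 2 * H * (w * (\<phi> * \<zeta>)) + H\<^sup>2 * (w * \<phi>\<^sup>2))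
    + 4 * H\<^sup>2 / \<delta> * ((2 * H + \<delta>) * (w * \<phi>\<^sup>2) + 2 * (w * (\<phi> * \<zeta>)))"
proof -
  define r where "r = 1 / \<delta>"
  have r: "r * \<delta> = 1" "8 * H\<^sup>2 / \<delta>\<^sup>2 = 8 * H\<^sup>2 * r\<^sup>2" "4 * H\<^sup>2 / \<delta> = 4 * H\<^sup>2 * r"
    using assms(1) by (simp_all add: r_def power_divide)
  define g where "g = \<zeta> + H * \<phi>"
  \<comment> \<open>A sum-of-squares certificate: up to \<open>r * \<delta> = 1\<close> this
    expression is the claimed right-hand side minus \<open>b\<close>.\<close>
  have "0 \<le> (1 + 8 * H\<^sup>2 * r\<^sup>2) * (b - w * \<zeta>\<^sup>2) + w * ((g + H * \<phi>)\<^sup>2 + 2 * H\<^sup>2 * (2 * g * r + \<phi>)\<^sup>2)"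
    using assms by (intro add_nonneg_nonneg mult_nonneg_nonneg) auto
  also have "\<dots> = (2 + 8 * H\<^sup>2 * r\<^sup>2) * (b + 2 * H * (w * (\<phi> * \<zeta>)) + H\<^sup>2 * (w * \<phi>\<^sup>2))
      + 4 * H\<^sup>2 * r * (2 * H * (w * \<phi>\<^sup>2) + 2 * (w * (\<phi> * \<zeta>))) + 4 * H\<^sup>2 * (w * \<phi>\<^sup>2) - b"
    by (simp add: g_def power2_eq_square algebra_simps)
  also have "4 * H\<^sup>2 * (w * \<phi>\<^sup>2) = 4 * H\<^sup>2 * (r * \<delta>) * (w * \<phi>\<^sup>2)" by (simp add: r(1))
  finally show ?thesis unfolding r(2,3) by (simp add: algebra_simps)
qed

subsection \<open>Integral inequalities\<close>

text \<open>Young's inequality is applied pointwise to the normalised functions \<open>u / U\<close>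
  and \<open>v / V\<close> and integrated; if \<open>U\<close> or \<open>V\<close> is zero, the
  integrand vanishes almost everywhere.\<close>

lemma Holder_integral_powr_le:
  fixes u v :: "'a \<Rightarrow> real"
  assumes u: "integrable M u" "\<And>x. 0 \<le> u x" and v: "integrable M v" "\<And>x. 0 \<le> v x"
    and \<theta>: "0 < \<theta>" "\<theta> < 1"
  shows "(\<integral>x. u x powr \<theta> * v x powr (1 - \<theta>) \<partial>M) \<le> (\<integral>x. u x \<partial>M) powr \<theta> * (\<integral>x. v x \<partial>M) powr (1 - \<theta>)"
proof -
  define U V where "U = (\<integral>x. u x \<partial>M)" and "V = (\<integral>x. v x \<partial>M)"
  have "U \<ge> 0" "V \<ge> 0" unfolding U_def V_def using u v by simp_all
  then consider "U = 0" | "V = 0" | "U > 0" "V > 0" by linarith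
  then show ?thesis
  proof cases
    case 1
    then have "AE x in M. u x = 0" using integral_nonneg_eq_0_iff_AE[OF u(1)] u(2) by (simp add: U_def)
    then have "(\<integral>x. u x powr \<theta> * v x powr (1 - \<theta>) \<partial>M) = 0" by (intro integral_eq_zero_AE) auto
    then show ?thesis by simp
  next
    case 2
    then have "AE x in M. v x = 0" using integral_nonneg_eq_0_iff_AE[OF v(1)] v(2) by (simp add: V_def)
    then have "(\<integral>x. u x powr \<theta> * v x powr (1 - \<theta>) \<partial>M) = 0" by (intro integral_eq_zero_AE) auto
    then show ?thesis by simp
  next
    case 3
    define c where "c = U powr \<theta> * V powr (1 - \<theta>)"
    have c: "c > 0" using 3 by (simp add: c_def)
    have young: "u x powr \<theta> * v x powr (1 - \<theta>) \<le> c * (\<theta> * (u x / U) + (1 - \<theta>) * (v x / V))" for x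
    proof -
      have "(u x / U) powr \<theta> * (v x / V) powr (1 - \<theta>) \<le> \<theta> * (u x / U) + (1 - \<theta>) * (v x / V)"
      proof (cases "u x = 0 \<or> v x = 0")
        case True
        then show ?thesis using u(2)[of x] v(2)[of x] 3 \<theta> by auto
      next
        case False
        then show ?thesis using u(2)[of x] v(2)[of x] 3 \<theta>
          by (intro Youngs_inequality_0) auto
      qed
      then have "c * ((u x / U) powr \<theta> * (v x / V) powr (1 - \<theta>)) \<le> c * (\<theta> * (u x / U) + (1 - \<theta>) * (v x / V))"
        using c by (intro mult_left_mono) auto
      also have "c * ((u x / U) powr \<theta> * (v x / V) powr (1 - \<theta>)) = u x powr \<theta> * v x powr (1 - \<theta>)"
        using 3 u(2)[of x] v(2)[of x] by (simp add: c_def powr_divide)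
      finally show ?thesis .
    qed
    \<comment> \<open>Were the product not integrable, its integral would be 0 by convention;
      \<open>integral_mono'\<close> handles that case through the nonnegative majorant.\<close>
    have "(\<integral>x. u x powr \<theta> * v x powr (1 - \<theta>) \<partial>M) \<le> (\<integral>x. c * (\<theta> * (u x / U) + (1 - \<theta>) * (v x / V)) \<partial>M)"
    proof (rule integral_mono')
      show "integrable M (\<lambda>x. c * (\<theta> * (u x / U) + (1 - \<theta>) * (v x / V)))"
        using u v by simp
    qed (use young u v c 3 \<theta> in auto)
    also have "\<dots> = c * (\<theta> * (U / U) + (1 - \<theta>) * (V / V))"
      using u v by (simp add: U_def V_def)
    also have "\<dots> = c" using 3 by simp
    finally show ?thesis by (simp add: c_def U_def V_def)
  qed
qed

text \<open>Compares a signed integrable lower bound with an integral that may be infinite. As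
  \<open>ennreal\<close> sends negative numbers to 0, it is enough to compare the positive part of
  \<open>h\<close>.\<close>

lemma ennreal_integral_le_nn_integral:
  fixes h F :: "'a \<Rightarrow> real"
  assumes h: "integrable M h" and le: "AE x in M. h x \<le> F x"
  shows "ennreal (\<integral>x. h x \<partial>M) \<le> (\<integral>\<^sup>+ x. ennreal (F x) \<partial>M)"
proof -
  have "ennreal (\<integral>x. h x \<partial>M) \<le> ennreal (\<integral>x. max 0 (h x) \<partial>M)"
    using h by (intro ennreal_leI integral_mono) auto
  also have "\<dots> = (\<integral>\<^sup>+ x. ennreal (max 0 (h x)) \<partial>M)"
    using h by (intro nn_integral_eq_integral[symmetric]) auto
  also have "\<dots> \<le> (\<integral>\<^sup>+ x. ennreal (F x) \<partial>M)"
    using le by (intro nn_integral_mono_AE) (auto elim!: eventually_mono simp: max_def ennreal_leI)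
  finally show ?thesis .
qed

subsection \<open>The Hardy and Rellich inequalities\<close>

lemma gauge_weight_add: "gauge_weight \<gamma> (\<beta> + \<delta>) z = gauge \<gamma> z powr \<delta> * gauge_weight \<gamma> \<beta> z"
  by (simp add: gauge_weight_def powr_add[symmetric] algebra_simps flip: powr_add)

lemma integrable_gauge_weight_mult:
  fixes h :: "'a::euclidean_space \<times> 'b::euclidean_space \<Rightarrow> real"
  assumes "\<gamma> > 0" "- hom_dim \<gamma> TYPE('a) TYPE('b) < \<beta>"
    and "compact S" "continuous_on UNIV h" "\<And>z. z \<notin> S \<Longrightarrow> h z = 0"
  shows "integrable lborel (\<lambda>z. gauge_weight \<gamma> \<beta> z * h z)"
    and "integrable lborel (\<lambda>z. gauge \<gamma> z powr \<beta> * h z)"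
  using gauge_weight_le[OF assms(1)]
  by (auto intro!: integrable_gauge_weight[OF assms])

text \<open>In the proof, \<open>e\<close> is the density of the completed square. Its nonnegativity
  gives the first claim once \<open>dilation_identity\<close> has turned the mixed term into a
  multiple of the integral of \<open>w f^2\<close>; the second claim integrates
  \<open>hardy_quadratic_form_le\<close> multiplied by \<rho>^\<delta>.\<close>

lemma improved_hardy:
  fixes f :: "'a::euclidean_space \<times> 'b::euclidean_space \<Rightarrow> real" and \<gamma> \<alpha> \<delta> :: real
  defines "Q \<equiv> hom_dim \<gamma> TYPE('a) TYPE('b)"
  defines "h \<equiv> (Q + \<alpha> - 4) / 2"
  assumes "\<gamma> > 0" "\<alpha> > 2" "\<delta> > 0" and f: "Cinf0 \<Omega> f"
    and M: "\<And>z. z \<in> \<Omega> \<Longrightarrow> gauge \<gamma> z \<le> M"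
  shows "h\<^sup>2 * (\<integral>z. gauge_weight \<gamma> (\<alpha> - 4) z * (f z)\<^sup>2 \<partial>lborel)
    \<le> (\<integral>z. gauge \<gamma> z powr (\<alpha> - 2) * grad_gamma_sq \<gamma> f z \<partial>lborel)" (is ?hardy)
    and "(\<integral>z. gauge \<gamma> z powr (\<alpha> - 2 + \<delta>) * grad_gamma_sq \<gamma> f z \<partial>lborel)
    \<le> (2 + 8 * h\<^sup>2 / \<delta>\<^sup>2) * M powr \<delta> *
       ((\<integral>z. gauge \<gamma> z powr (\<alpha> - 2) * grad_gamma_sq \<gamma> f z \<partial>lborel)
        - h\<^sup>2 * (\<integral>z. gauge_weight \<gamma> (\<alpha> - 4) z * (f z)\<^sup>2 \<partial>lborel))" (is ?improved)
proof -
  obtain S where S: "compact S" "S \<subseteq> \<Omega>" "\<And>z. z \<notin> S \<Longrightarrow> f z = 0"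
    "\<And>z. z \<notin> S \<Longrightarrow> frechet_derivative f (at z) = (\<lambda>_. 0)" using Cinf0_support[OF f] by metis
  have hQ: "2 * h = \<alpha> - 4 + Q" by (simp add: h_def)
  define K where "K = 2 + 8 * h\<^sup>2 / \<delta>\<^sup>2"
  define L where "L = 4 * h\<^sup>2 / \<delta>"
  define E where "E = euler_deriv \<gamma> f"
  define G where "G = grad_gamma_sq \<gamma> f"
  define w :: "'a \<times> 'b \<Rightarrow> real" where "w = gauge_weight \<gamma> (\<alpha> - 4)"
  define w' :: "'a \<times> 'b \<Rightarrow> real" where "w' = gauge_weight \<gamma> (\<alpha> - 4 + \<delta>)"
  have Ec: "continuous_on UNIV E" unfolding E_def by (rule continuous_on_euler_deriv[OF f])
  have fc: "continuous_on UNIV f" by (rule Cinf0_has_derivative(5)[OF f])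
  have Gc: "continuous_on UNIV G" unfolding G_def by (rule continuous_on_grad_gamma_sq[OF f \<open>\<gamma> > 0\<close>])
  have G0: "G z = 0" if "z \<notin> S" for z using S(4)[OF that] by (simp add: G_def grad_gamma_sq_def)
  have Q2: "Q > 2" using hom_dim_gt_2[OF \<open>\<gamma> > 0\<close>, where 'a='a and 'b='b] by (simp add: Q_def)
  have \<beta>: "- hom_dim \<gamma> TYPE('a) TYPE('b) < \<alpha> - 4" "- hom_dim \<gamma> TYPE('a) TYPE('b) < \<alpha> - 4 + \<delta>"
    "- hom_dim \<gamma> TYPE('a) TYPE('b) < \<alpha> - 2" "- hom_dim \<gamma> TYPE('a) TYPE('b) < \<alpha> - 2 + \<delta>"
    using Q2 assms by (auto simp: Q_def)
  note int = integrable_gauge_weight_mult[OF \<open>\<gamma> > 0\<close> _ S(1)]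
  have iw: "integrable lborel (\<lambda>z. w z * (f z)\<^sup>2)" "integrable lborel (\<lambda>z. w z * (f z * E z))"
    "integrable lborel (\<lambda>z. w' z * (f z)\<^sup>2)" "integrable lborel (\<lambda>z. w' z * (f z * E z))"
    unfolding w_def w'_def using S(3) by (intro int(1) \<beta> continuous_intros fc Ec; simp)+
  have ib: "integrable lborel (\<lambda>z. gauge \<gamma> z powr (\<alpha> - 2) * G z)"
    "integrable lborel (\<lambda>z. gauge \<gamma> z powr (\<alpha> - 2 + \<delta>) * G z)"
    using G0 by (intro int(2) \<beta> Gc; simp)+
  define e where "e z = gauge \<gamma> z powr (\<alpha> - 2) * G z + 2 * h * (w z * (f z * E z)) + h\<^sup>2 * (w z * (f z)\<^sup>2)" for z
  define k where "k z = (2 * h + \<delta>) * (w' z * (f z)\<^sup>2) + 2 * (w' z * (f z * E z))" for z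
  have CS: "w z * (E z)\<^sup>2 \<le> gauge \<gamma> z powr (\<alpha> - 2) * G z" for z
    using gauge_weight_euler_deriv_le[OF \<open>\<gamma> > 0\<close> f, of "\<alpha> - 4" z] by (simp add: w_def E_def G_def)
  have w0: "w z \<ge> 0" for z by (simp add: w_def)
  have w': "w' z = gauge \<gamma> z powr \<delta> * w z" for z by (simp add: w'_def w_def gauge_weight_add)
  have e0: "e z \<ge> 0" for z
  proof -
    have "0 \<le> w z * (E z + h * f z)\<^sup>2" using w0 by simp
    also have "\<dots> = w z * (E z)\<^sup>2 + 2 * h * (w z * (f z * E z)) + h\<^sup>2 * (w z * (f z)\<^sup>2)"
      by (simp add: power2_eq_square algebra_simps)
    also have "\<dots> \<le> e z" using CS[of z] by (simp add: e_def)
    finally show ?thesis .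
  qed
  have K0: "K \<ge> 0" by (simp add: K_def)
  have pt: "gauge \<gamma> z powr (\<alpha> - 2 + \<delta>) * G z \<le> K * M powr \<delta> * e z + L * k z" for z
  proof (cases "z \<in> S")
    case True
    have "gauge \<gamma> z powr (\<alpha> - 2) * G z \<le> K * e z + L * ((2 * h + \<delta>) * (w z * (f z)\<^sup>2) + 2 * (w z * (f z * E z)))"
      unfolding K_def L_def e_def by (rule hardy_quadratic_form_le[OF \<open>\<delta> > 0\<close> w0 CS])
    then have "gauge \<gamma> z powr \<delta> * (gauge \<gamma> z powr (\<alpha> - 2) * G z)
        \<le> gauge \<gamma> z powr \<delta> * (K * e z + L * ((2 * h + \<delta>) * (w z * (f z)\<^sup>2) + 2 * (w z * (f z * E z))))"
      by (intro mult_left_mono) auto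
    also have "\<dots> = gauge \<gamma> z powr \<delta> * (K * e z) + L * k z"
      by (simp add: k_def w' algebra_simps)
    \<comment> \<open>The bound \<open>M\<close> for the gauge on \<Omega> enters here; it may be
      applied because \<open>e\<close> is nonnegative.\<close>
    also have "gauge \<gamma> z powr \<delta> * (K * e z) \<le> M powr \<delta> * (K * e z)"
      using M[of z] True S(2) \<open>\<delta> > 0\<close> e0 K0 by (intro mult_right_mono powr_mono2) auto
    finally show ?thesis by (simp add: powr_add mult_ac)
  next
    case False
    then show ?thesis using S(3) G0 by (simp add: e_def k_def)
  qed
  have dil: "(\<integral>z. 2 * h * (w z * (f z)\<^sup>2) + 2 * (w z * (f z * E z)) \<partial>lborel) = 0"
    using dilation_identity[OF \<open>\<gamma> > 0\<close> \<beta>(1) f] by (simp add: hQ Q_def w_def E_def)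
  \<comment> \<open>The coefficient in \<open>k\<close> is \<beta> + Q for \<beta> = \<alpha> - 4 +
    \<delta>, so \<open>dilation_identity\<close> with that exponent makes \<open>k\<close>
    integrate to zero.\<close>
  have k_coeff: "2 * h + \<delta> = \<alpha> - 4 + \<delta> + Q" using hQ by simp
  have "(\<integral>z. k z \<partial>lborel) = 0"
    using dilation_identity[OF \<open>\<gamma> > 0\<close> \<beta>(2) f] unfolding k_def k_coeff by (simp add: w'_def E_def Q_def)
  moreover have eI: "(\<integral>z. e z \<partial>lborel) = (\<integral>z. gauge \<gamma> z powr (\<alpha> - 2) * G z \<partial>lborel) - h\<^sup>2 * (\<integral>z. w z * (f z)\<^sup>2 \<partial>lborel)"
  proof -
    have "(\<integral>z. w z * (f z * E z) \<partial>lborel) = - h * (\<integral>z. w z * (f z)\<^sup>2 \<partial>lborel)"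
      using dil iw by simp
    then show ?thesis unfolding e_def using iw ib by (simp add: power2_eq_square)
  qed
  moreover have "(\<integral>z. gauge \<gamma> z powr (\<alpha> - 2 + \<delta>) * G z \<partial>lborel) \<le> (\<integral>z. K * M powr \<delta> * e z + L * k z \<partial>lborel)"
    by (intro integral_mono pt ib) (use iw ib in \<open>auto simp: e_def k_def\<close>)
  moreover have "\<dots> = K * M powr \<delta> * (\<integral>z. e z \<partial>lborel) + L * (\<integral>z. k z \<partial>lborel)"
    using iw ib by (simp add: e_def[abs_def] k_def[abs_def])
  ultimately show ?improved by (simp add: K_def G_def w_def)
  have "0 \<le> (\<integral>z. e z \<partial>lborel)" using e0 by simp
  then show ?hardy unfolding eI by (simp add: G_def w_def)
qed

text \<open>Integrate \<open>(a + 2 * \<epsilon> * b)^2 \<ge> 0\<close>, where \<open>a^2\<close> is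
  the Rellich integrand, \<open>b^2\<close> the Hardy density and \<open>a * b\<close> the integrand
  of Green's identity; the two integral identities then leave only \<open>B\<close> and
  \<open>D\<close>.\<close>

lemma rellich_lower_bound:
  fixes f :: "'a::euclidean_space \<times> 'b::euclidean_space \<Rightarrow> real" and \<gamma> \<alpha> :: real
  defines "Q \<equiv> hom_dim \<gamma> TYPE('a) TYPE('b)"
  assumes "\<gamma> > 0" "\<alpha> > 2" and f: "Cinf0 \<Omega> f"
  shows "ennreal (((Q - \<alpha>) / 2)\<^sup>2 * (\<integral>z. gauge \<gamma> z powr (\<alpha> - 2) * grad_gamma_sq \<gamma> f z \<partial>lborel)
      + (Q - \<alpha>) * (Q + 3 * \<alpha> - 8) / 4 *
         ((\<integral>z. gauge \<gamma> z powr (\<alpha> - 2) * grad_gamma_sq \<gamma> f z \<partial>lborel)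
          - ((Q + \<alpha> - 4) / 2)\<^sup>2 * (\<integral>z. gauge_weight \<gamma> (\<alpha> - 4) z * (f z)\<^sup>2 \<partial>lborel)))
    \<le> (\<integral>\<^sup>+ z\<in>\<Omega>. ennreal (gauge \<gamma> z powr \<alpha> * (grushin_laplacian \<gamma> f z)\<^sup>2
           / (grad_gamma_norm \<gamma> (gauge \<gamma>) z)\<^sup>2) \<partial>lborel)"
proof -
  obtain S where S: "compact S" "S \<subseteq> \<Omega>" "\<And>z. z \<notin> S \<Longrightarrow> f z = 0"
    "\<And>z. z \<notin> S \<Longrightarrow> frechet_derivative f (at z) = (\<lambda>_. 0)" using Cinf0_support[OF f] by metis
  define H where "H = (Q + \<alpha> - 4) / 2"
  define \<epsilon> where "\<epsilon> = (Q - \<alpha>) * H / 4"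
  define E where "E = euler_deriv \<gamma> f"
  define G where "G = grad_gamma_sq \<gamma> f"
  define P where "P = grushin_laplacian \<gamma> f"
  define w :: "'a \<times> 'b \<Rightarrow> real" where "w = gauge_weight \<gamma> (\<alpha> - 4)"
  have Ec: "continuous_on UNIV E" unfolding E_def by (rule continuous_on_euler_deriv[OF f])
  have fc: "continuous_on UNIV f" by (rule Cinf0_has_derivative(5)[OF f])
  have Gc: "continuous_on UNIV G" unfolding G_def by (rule continuous_on_grad_gamma_sq[OF f \<open>\<gamma> > 0\<close>])
  have Pc: "continuous_on UNIV P" unfolding P_def by (rule continuous_on_grushin_laplacian[OF f \<open>\<gamma> > 0\<close>])
  have G0: "G z = 0" if "z \<notin> S" for z using S(4)[OF that] by (simp add: G_def grad_gamma_sq_def)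
  have Q2: "Q > 2" using hom_dim_gt_2[OF \<open>\<gamma> > 0\<close>, where 'a='a and 'b='b] by (simp add: Q_def)
  have \<beta>: "- hom_dim \<gamma> TYPE('a) TYPE('b) < \<alpha> - 4" "- hom_dim \<gamma> TYPE('a) TYPE('b) < \<alpha> - 2"
    using Q2 assms by (auto simp: Q_def)
  note int = integrable_gauge_weight_mult[OF \<open>\<gamma> > 0\<close> _ S(1)]
  have iw: "integrable lborel (\<lambda>z. w z * (f z)\<^sup>2)" "integrable lborel (\<lambda>z. w z * (f z * E z))"
    unfolding w_def using S(3) by (intro int(1) \<beta> continuous_intros fc Ec; simp)+
  have ib: "integrable lborel (\<lambda>z. gauge \<gamma> z powr (\<alpha> - 2) * G z)"
    "integrable lborel (\<lambda>z. gauge \<gamma> z powr (\<alpha> - 2) * (f z * P z))"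
    using G0 S(3) by (intro int(2) \<beta> continuous_intros Gc fc Pc; simp)+
  define B D T where "B = (\<integral>z. gauge \<gamma> z powr (\<alpha> - 2) * G z \<partial>lborel)"
    and "D = (\<integral>z. w z * (f z)\<^sup>2 \<partial>lborel)" and "T = (\<integral>z. w z * (f z * E z) \<partial>lborel)"
  have "(\<integral>z. (\<alpha> - 4 + Q) * (w z * (f z)\<^sup>2) + 2 * (w z * (f z * E z)) \<partial>lborel) = 0"
    using dilation_identity[OF \<open>\<gamma> > 0\<close> \<beta>(1) f] by (simp add: Q_def w_def E_def)
  then have "(\<alpha> - 4 + Q) * D + 2 * T = 0" using iw by (simp add: T_def D_def)
  then have T: "T = - H * D" by (simp add: H_def field_simps)
  have "(\<integral>z. gauge \<gamma> z powr (\<alpha> - 2) * (f z * P z) + gauge \<gamma> z powr (\<alpha> - 2) * G z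
      + (\<alpha> - 2) * (w z * (f z * E z)) \<partial>lborel) = 0"
    using rellich_green_identity[OF \<open>\<gamma> > 0\<close> \<open>\<alpha> > 2\<close> f] by (simp add: P_def G_def w_def E_def)
  then have N: "(\<integral>z. gauge \<gamma> z powr (\<alpha> - 2) * (f z * P z) \<partial>lborel) = - B + (\<alpha> - 2) * H * D"
    using iw ib T by (simp add: B_def T_def)
  \<comment> \<open>\<open>\<epsilon>\<close> is chosen so that the Young inequality \<open>F \<ge> h\<close> leaves \<open>B - H\<^sup>2 D\<close> with the required factor.\<close>
  define h where "h z = - (4 * \<epsilon>) * (gauge \<gamma> z powr (\<alpha> - 2) * (f z * P z)) - 4 * \<epsilon>\<^sup>2 * (w z * (f z)\<^sup>2)" for z
  have hi: "integrable lborel h" unfolding h_def[abs_def] using iw ib by simp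
  have "(\<integral>z. h z \<partial>lborel) = - (4 * \<epsilon>) * (\<integral>z. gauge \<gamma> z powr (\<alpha> - 2) * (f z * P z) \<partial>lborel) - 4 * \<epsilon>\<^sup>2 * D"
    unfolding h_def D_def using iw ib by simp
  also have "\<dots> = 4 * \<epsilon> * (B - (\<alpha> - 2) * H * D) - 4 * \<epsilon>\<^sup>2 * D"
    unfolding N by (simp add: algebra_simps)
  \<comment> \<open>With 4\<epsilon> = (Q - \<alpha>)H, the total coefficient of \<open>B\<close> is
    (Q - \<alpha>)(Q + \<alpha> - 4)/2 on either side.\<close>
  also have "\<dots> = ((Q - \<alpha>) / 2)\<^sup>2 * B + (Q - \<alpha>) * (Q + 3 * \<alpha> - 8) / 4 * (B - H\<^sup>2 * D)"
    by (simp add: \<epsilon>_def H_def power2_eq_square field_simps)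
  finally have hI: "(\<integral>z. h z \<partial>lborel) = \<dots>" .
  define F where "F z = gauge \<gamma> z powr \<alpha> * (P z)\<^sup>2 / (grad_gamma_norm \<gamma> (gauge \<gamma>) z)\<^sup>2 * indicator \<Omega> z" for z
  have "h z \<le> F z" if z: "fst z \<noteq> 0" for z
  proof (cases "z \<in> S")
    case False
    then show ?thesis using S(3) by (simp add: h_def F_def)
  next
    case True
    then have "z \<in> \<Omega>" using S(2) by auto
    define g n where "g = gauge \<gamma> z" and "n = norm (fst z)"
    have "z \<noteq> 0" using z by (metis fst_zero)
    then have g: "g > 0" using gauge_pos[OF \<open>\<gamma> > 0\<close>] by (simp add: g_def)
    have n: "n > 0" using z by (simp add: n_def)
    \<comment> \<open>The powers are distributed so that the degenerate factor |x|^\<gamma> cancels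
      in \<open>a * b\<close>, which uses that x is nonzero.\<close>
    define a where "a = g powr (\<alpha> / 2 + \<gamma>) / n powr \<gamma> * P z"
    define b where "b = g powr (\<alpha> / 2 - 2 - \<gamma>) * n powr \<gamma> * f z"
    have sq: "(x powr c)\<^sup>2 = x powr (2 * c)" for x c :: real by (simp add: power2_eq_square flip: powr_add)
    have "F z = g powr \<alpha> * (P z)\<^sup>2 / (n powr (2 * \<gamma>) / g powr (2 * \<gamma>))"
      using \<open>z \<in> \<Omega>\<close> by (simp add: F_def grad_gamma_norm_sq grad_gamma_sq_gauge[OF \<open>\<gamma> > 0\<close> z] g_def n_def)
    also have "\<dots> = a\<^sup>2"
      by (simp add: a_def power_mult_distrib power_divide sq distrib_left powr_add)
    finally have Fa: "F z = a\<^sup>2" .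
    have wb: "w z * (f z)\<^sup>2 = b\<^sup>2"
      by (simp add: b_def w_def gauge_weight_def power_mult_distrib sq right_diff_distrib g_def n_def)
    have ab: "gauge \<gamma> z powr (\<alpha> - 2) * (f z * P z) = a * b"
    proof -
      have "a * b = (g powr (\<alpha> / 2 + \<gamma>) * g powr (\<alpha> / 2 - 2 - \<gamma>)) * (f z * P z)"
        using n by (simp add: a_def b_def)
      also have "g powr (\<alpha> / 2 + \<gamma>) * g powr (\<alpha> / 2 - 2 - \<gamma>) = g powr (\<alpha> - 2)"
        unfolding powr_add[symmetric] by simp
      finally show ?thesis by (simp add: g_def)
    qed
    have "0 \<le> (a + 2 * \<epsilon> * b)\<^sup>2" by simp
    then show ?thesis unfolding h_def Fa wb ab by (simp add: power2_eq_square algebra_simps)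
  qed
  then have "AE z in lborel. h z \<le> F z" using AE_fst_neq_0 by (auto elim!: eventually_mono)
  from ennreal_integral_le_nn_integral[OF hi this]
  have "ennreal (((Q - \<alpha>) / 2)\<^sup>2 * B + (Q - \<alpha>) * (Q + 3 * \<alpha> - 8) / 4 * (B - H\<^sup>2 * D)) \<le> (\<integral>\<^sup>+ z. ennreal (F z) \<partial>lborel)"
    by (simp only: hI)
  also have "(\<integral>\<^sup>+ z. ennreal (F z) \<partial>lborel) = (\<integral>\<^sup>+ z\<in>\<Omega>. ennreal (gauge \<gamma> z powr \<alpha> * (grushin_laplacian \<gamma> f z)\<^sup>2
           / (grad_gamma_norm \<gamma> (gauge \<gamma>) z)\<^sup>2) \<partial>lborel)"
    by (intro nn_integral_cong) (auto simp: F_def P_def indicator_def)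
  finally show ?thesis by (simp add: H_def B_def D_def G_def w_def)
qed

section \<open>Passage to the q-th power and conclusion\<close>

text \<open>Hoelder with \<theta> = q/2 separates the weighted squared gradient from 1/\<rho> on
  \<Omega>. The surplus exponent (2 - q)/q is the one for which the extra powers of \<rho> cancel,
  and 1/\<rho> is integrable on \<Omega> because Q > 1.\<close>

lemma weighted_grad_Lq_le:
  fixes f :: "'a::euclidean_space \<times> 'b::euclidean_space \<Rightarrow> real"
  assumes "\<gamma> > 0" "0 < q" "q < 2" "2 < \<alpha>" and f: "Cinf0 \<Omega> f"
    and \<Omega>: "bounded \<Omega>" "\<Omega> \<in> sets borel"
  shows "(LINT z:\<Omega>|lborel. grad_gamma_norm \<gamma> f z powr q * gauge \<gamma> z powr (q * (\<alpha> - 2) / 2)) powr (2 / q)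
    \<le> (\<integral>z. gauge \<gamma> z powr (\<alpha> - 2 + (2 - q) / q) * grad_gamma_sq \<gamma> f z \<partial>lborel)
      * (\<integral>z. indicator \<Omega> z * gauge \<gamma> z powr (- 1) \<partial>lborel) powr ((2 - q) / q)"
proof -
  obtain S where S: "compact S" "\<And>z. z \<notin> S \<Longrightarrow> frechet_derivative f (at z) = (\<lambda>_. 0)"
    using Cinf0_support[OF f] by metis
  define \<delta> where "\<delta> = (2 - q) / q"
  have \<delta>: "\<delta> > 0" using assms by (simp add: \<delta>_def)
  define G where "G = grad_gamma_sq \<gamma> f"
  have Gc: "continuous_on UNIV G" unfolding G_def by (rule continuous_on_grad_gamma_sq[OF f \<open>\<gamma> > 0\<close>])
  have G0: "G z = 0" if "z \<notin> S" for z using S(2)[OF that] by (simp add: G_def grad_gamma_sq_def)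
  have Q2: "hom_dim \<gamma> TYPE('a) TYPE('b) > 2" by (rule hom_dim_gt_2[OF \<open>\<gamma> > 0\<close>])
  define u where "u z = gauge \<gamma> z powr (\<alpha> - 2 + \<delta>) * G z" for z
  define v where "v z = indicator \<Omega> z * gauge \<gamma> z powr (- 1)" for z
  have u: "integrable lborel u" "\<And>z. 0 \<le> u z"
    unfolding u_def[abs_def] using Q2 \<delta> assms G0
    by (intro integrable_gauge_weight_mult(2)[OF \<open>\<gamma> > 0\<close> _ S(1) Gc]; simp) (simp add: G_def)
  have v: "integrable lborel v" "\<And>z. 0 \<le> v z"
    unfolding v_def[abs_def] using Q2 by (intro integrable_gauge_powr[OF \<open>\<gamma> > 0\<close> _ \<Omega>]; simp) simp
  have eq: "indicator \<Omega> z *\<^sub>R (grad_gamma_norm \<gamma> f z powr q * gauge \<gamma> z powr (q * (\<alpha> - 2) / 2))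
      = u z powr (q / 2) * v z powr (1 - q / 2)" for z
  proof (cases "z \<in> \<Omega>")
    case True
    have "grad_gamma_norm \<gamma> f z = G z powr (1 / 2)"
      by (simp add: grad_gamma_norm_def G_def powr_half_sqrt)
    then have 1: "grad_gamma_norm \<gamma> f z powr q = G z powr (q / 2)" by (simp add: powr_powr)
    have 2: "(\<alpha> - 2 + \<delta>) * (q / 2) + (- 1) * (1 - q / 2) = q * (\<alpha> - 2) / 2"
      using assms(2) by (simp add: \<delta>_def field_simps)
    have "u z powr (q / 2) * v z powr (1 - q / 2)
        = G z powr (q / 2) * (gauge \<gamma> z powr ((\<alpha> - 2 + \<delta>) * (q / 2)) * gauge \<gamma> z powr ((- 1) * (1 - q / 2)))"
    proof -
      have "v z = gauge \<gamma> z powr (- 1)" using True by (simp add: v_def)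
      then have "v z powr (1 - q / 2) = gauge \<gamma> z powr ((- 1) * (1 - q / 2))" by (simp only: powr_powr)
      moreover have "u z powr (q / 2) = gauge \<gamma> z powr ((\<alpha> - 2 + \<delta>) * (q / 2)) * G z powr (q / 2)"
        by (simp add: u_def powr_mult powr_powr G_def)
      ultimately show ?thesis by (simp only: mult_ac)
    qed
    also have "\<dots> = G z powr (q / 2) * gauge \<gamma> z powr (q * (\<alpha> - 2) / 2)"
      unfolding powr_add[symmetric] 2 ..
    finally show ?thesis using True 1 by simp
  next
    case False
    then show ?thesis using assms(3) by (simp add: v_def)
  qed
  have "(LINT z:\<Omega>|lborel. grad_gamma_norm \<gamma> f z powr q * gauge \<gamma> z powr (q * (\<alpha> - 2) / 2))
      = (\<integral>z. u z powr (q / 2) * v z powr (1 - q / 2) \<partial>lborel)"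
    unfolding set_lebesgue_integral_def eq ..
  also have "\<dots> \<le> (\<integral>z. u z \<partial>lborel) powr (q / 2) * (\<integral>z. v z \<partial>lborel) powr (1 - q / 2)"
    using assms by (intro Holder_integral_powr_le u v) auto
  finally have "(LINT z:\<Omega>|lborel. grad_gamma_norm \<gamma> f z powr q * gauge \<gamma> z powr (q * (\<alpha> - 2) / 2)) powr (2 / q)
      \<le> ((\<integral>z. u z \<partial>lborel) powr (q / 2) * (\<integral>z. v z \<partial>lborel) powr (1 - q / 2)) powr (2 / q)"
    using assms(2) by (intro powr_mono2) (auto simp: set_lebesgue_integral_def)
  also have "\<dots> = (\<integral>z. u z \<partial>lborel) * (\<integral>z. v z \<partial>lborel) powr \<delta>"
  proof -
    have "(\<integral>z. u z \<partial>lborel) \<ge> 0" "(\<integral>z. v z \<partial>lborel) \<ge> 0" using u v by simp_all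
    moreover have "(1 - q / 2) * (2 / q) = \<delta>" using assms(2) by (simp add: \<delta>_def field_simps)
    ultimately show ?thesis using assms(2) by (simp add: powr_mult powr_powr)
  qed
  finally show ?thesis by (simp add: u_def[abs_def] v_def[abs_def] G_def \<delta>_def)
qed

theorem theorem4p7:
  fixes \<gamma> q \<alpha> :: real
    and \<Omega> :: "('a::euclidean_space \<times> 'b::euclidean_space) set"
  defines "Q \<equiv> hom_dim \<gamma> TYPE('a) TYPE('b)"
  assumes "\<gamma> > 0"
    and "smooth_bounded_domain \<Omega>" and "0 \<in> \<Omega>"
    and "1 < q" and "q < 2"
    and "2 < \<alpha>" and "\<alpha> < Q"
  shows "\<exists>C>0. \<forall>\<phi>. Cinf0 \<Omega> \<phi> \<longrightarrow>
    (\<integral>\<^sup>+ z\<in>\<Omega>. ennreal (gauge \<gamma> z powr \<alpha> * (grushin_laplacian \<gamma> \<phi> z)\<^sup>2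
                       / (grad_gamma_norm \<gamma> (gauge \<gamma>) z)\<^sup>2) \<partial>lborel)
    \<ge> ennreal (((Q - \<alpha>) / 2)\<^sup>2) *
        (\<integral>\<^sup>+ z\<in>\<Omega>. ennreal (gauge \<gamma> z powr \<alpha> * (grad_gamma_norm \<gamma> \<phi> z)\<^sup>2 / (gauge \<gamma> z)\<^sup>2) \<partial>lborel)
      + ennreal (C * (Q - \<alpha>) * (Q + 3 * \<alpha> - 8) / 4 *
        (LINT z:\<Omega>|lborel. grad_gamma_norm \<gamma> \<phi> z powr q * gauge \<gamma> z powr (q * (\<alpha> - 2) / 2)) powr (2 / q))"
proof -
  have \<Omega>: "bounded \<Omega>" "\<Omega> \<in> sets borel"
    using assms(3) by (auto simp: smooth_bounded_domain_def)
  define H where "H = (Q + \<alpha> - 4) / 2"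
  define \<delta> where "\<delta> = (2 - q) / q"
  have \<delta>: "\<delta> > 0" using assms by (simp add: \<delta>_def)
  obtain M where M: "\<And>z. z \<in> \<Omega> \<Longrightarrow> gauge \<gamma> z \<le> M"
  proof -
    have "compact (gauge \<gamma> ` closure \<Omega>)"
      using \<Omega> continuous_on_gauge[OF \<open>\<gamma> > 0\<close>] by (intro compact_continuous_image) auto
    then obtain M where "\<forall>x\<in>gauge \<gamma> ` closure \<Omega>. norm x \<le> M"
      using compact_imp_bounded bounded_iff by metis
    then show ?thesis using closure_subset[of \<Omega>] by (intro that[of M]) auto
  qed
  define V where "V = (\<integral>z. indicator \<Omega> z * gauge \<gamma> z powr (- 1) \<partial>lborel) powr \<delta>"
  define K where "K = (2 + 8 * H\<^sup>2 / \<delta>\<^sup>2) * M powr \<delta> * V"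
  have K: "K \<ge> 0" unfolding K_def V_def by (intro mult_nonneg_nonneg add_nonneg_nonneg) auto
  \<comment> \<open>\<open>K\<close> is fixed before \<phi>, as uniformity demands. Adding 1 keeps
    \<open>C\<close> positive and well defined even if \<open>K\<close> is 0, and costs nothing
    because \<open>B - H^2 D\<close> is nonnegative.\<close>
  define C where "C = 1 / (K + 1)"
  show ?thesis
  proof (intro exI[of _ C] conjI allI impI)
    show "C > 0" using K by (simp add: C_def)
    fix \<phi> :: "'a \<times> 'b \<Rightarrow> real" assume \<phi>: "Cinf0 \<Omega> \<phi>"
    obtain S where S: "compact S" "S \<subseteq> \<Omega>" "\<And>z. z \<notin> S \<Longrightarrow> frechet_derivative \<phi> (at z) = (\<lambda>_. 0)"
      using Cinf0_support[OF \<phi>] by metis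
    define G where "G = grad_gamma_sq \<gamma> \<phi>"
    have G0: "G z = 0" if "z \<notin> S" for z using S(3)[OF that] by (simp add: G_def grad_gamma_sq_def)
    define B D R where "B = (\<integral>z. gauge \<gamma> z powr (\<alpha> - 2) * G z \<partial>lborel)"
      and "D = (\<integral>z. gauge_weight \<gamma> (\<alpha> - 4) z * (\<phi> z)\<^sup>2 \<partial>lborel)"
      and "R = (LINT z:\<Omega>|lborel. grad_gamma_norm \<gamma> \<phi> z powr q * gauge \<gamma> z powr (q * (\<alpha> - 2) / 2)) powr (2 / q)"
    have B0: "B \<ge> 0" unfolding B_def G_def by simp
    have R0: "R \<ge> 0" by (simp add: R_def)
    define c where "c = (Q - \<alpha>) * (Q + 3 * \<alpha> - 8) / 4"
    have c: "c \<ge> 0" using assms by (simp add: c_def)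
    have "R \<le> (\<integral>z. gauge \<gamma> z powr (\<alpha> - 2 + \<delta>) * G z \<partial>lborel) * V"
      using weighted_grad_Lq_le[OF _ _ _ _ \<phi> \<Omega>, of \<gamma> q \<alpha>] assms by (simp add: R_def G_def V_def \<delta>_def)
    also have "\<dots> \<le> ((2 + 8 * H\<^sup>2 / \<delta>\<^sup>2) * M powr \<delta> * (B - H\<^sup>2 * D)) * V"
      using improved_hardy(2)[OF \<open>\<gamma> > 0\<close> \<open>2 < \<alpha>\<close> \<delta> \<phi> M]
      by (intro mult_right_mono) (simp_all add: B_def D_def G_def H_def Q_def V_def)
    also have "\<dots> = K * (B - H\<^sup>2 * D)" by (simp add: K_def)
    finally have RK: "R \<le> K * (B - H\<^sup>2 * D)" .
    have CR: "C * R \<le> B - H\<^sup>2 * D"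
    proof -
      have "0 \<le> B - H\<^sup>2 * D"
        using improved_hardy(1)[OF \<open>\<gamma> > 0\<close> \<open>2 < \<alpha>\<close> \<delta> \<phi> M] by (simp add: B_def D_def G_def H_def Q_def)
      then have "R \<le> (K + 1) * (B - H\<^sup>2 * D)" using RK by (simp add: algebra_simps)
      then show ?thesis using K by (simp add: C_def field_simps)
    qed
    have B: "(\<integral>\<^sup>+ z\<in>\<Omega>. ennreal (gauge \<gamma> z powr \<alpha> * (grad_gamma_norm \<gamma> \<phi> z)\<^sup>2 / (gauge \<gamma> z)\<^sup>2) \<partial>lborel) = ennreal B"
    proof -
      have "ennreal (gauge \<gamma> z powr \<alpha> * (grad_gamma_norm \<gamma> \<phi> z)\<^sup>2 / (gauge \<gamma> z)\<^sup>2) * indicator \<Omega> z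
          = ennreal (gauge \<gamma> z powr (\<alpha> - 2) * G z)" for z
      proof (cases "z \<in> S")
        case True
        \<comment> \<open>At the origin both sides are 0 by the conventions for division by zero and
          for powers of 0.\<close>
        have "gauge \<gamma> z powr \<alpha> / (gauge \<gamma> z)\<^sup>2 = gauge \<gamma> z powr (\<alpha> - 2)"
          by (cases "gauge \<gamma> z = 0") (simp_all add: powr_diff)
        then have "gauge \<gamma> z powr \<alpha> * G z / (gauge \<gamma> z)\<^sup>2 = gauge \<gamma> z powr (\<alpha> - 2) * G z"
          by (metis times_divide_eq_left)
        moreover have "z \<in> \<Omega>" using True S(2) by blast
        ultimately show ?thesis by (simp add: grad_gamma_norm_sq flip: G_def)
      next
        case False
        then show ?thesis using G0[OF False] by (simp add: grad_gamma_norm_sq flip: G_def)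
      qed
      moreover have "integrable lborel (\<lambda>z. gauge \<gamma> z powr (\<alpha> - 2) * G z)"
        using hom_dim_gt_2[OF \<open>\<gamma> > 0\<close>, where 'a='a and 'b='b] assms G0
        by (intro integrable_gauge_weight_mult(2)[OF _ _ S(1)])
          (auto simp: G_def intro: continuous_on_grad_gamma_sq[OF \<phi>])
      ultimately show ?thesis by (simp add: B_def nn_integral_eq_integral G_def)
    qed
    \<comment> \<open>All summands are nonnegative, so they merge into one \<open>ennreal\<close> of
      a real number and the estimates become real inequalities.\<close>
    have "ennreal (((Q - \<alpha>) / 2)\<^sup>2) * ennreal B + ennreal (c * (C * R))
        = ennreal (((Q - \<alpha>) / 2)\<^sup>2 * B + c * (C * R))"
      using B0 c R0 K by (simp add: ennreal_plus ennreal_mult C_def)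
    also have "\<dots> \<le> ennreal (((Q - \<alpha>) / 2)\<^sup>2 * B + c * (B - H\<^sup>2 * D))"
      using CR c by (intro ennreal_leI add_left_mono mult_left_mono)
    also have "\<dots> \<le> (\<integral>\<^sup>+ z\<in>\<Omega>. ennreal (gauge \<gamma> z powr \<alpha> * (grushin_laplacian \<gamma> \<phi> z)\<^sup>2
                       / (grad_gamma_norm \<gamma> (gauge \<gamma>) z)\<^sup>2) \<partial>lborel)"
      using rellich_lower_bound[OF \<open>\<gamma> > 0\<close> \<open>2 < \<alpha>\<close> \<phi>] by (simp add: B_def D_def G_def H_def Q_def c_def)
    finally show "ennreal (((Q - \<alpha>) / 2)\<^sup>2) *
        (\<integral>\<^sup>+ z\<in>\<Omega>. ennreal (gauge \<gamma> z powr \<alpha> * (grad_gamma_norm \<gamma> \<phi> z)\<^sup>2 / (gauge \<gamma> z)\<^sup>2) \<partial>lborel)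
      + ennreal (C * (Q - \<alpha>) * (Q + 3 * \<alpha> - 8) / 4 *
        (LINT z:\<Omega>|lborel. grad_gamma_norm \<gamma> \<phi> z powr q * gauge \<gamma> z powr (q * (\<alpha> - 2) / 2)) powr (2 / q))
      \<le> (\<integral>\<^sup>+ z\<in>\<Omega>. ennreal (gauge \<gamma> z powr \<alpha> * (grushin_laplacian \<gamma> \<phi> z)\<^sup>2
                       / (grad_gamma_norm \<gamma> (gauge \<gamma>) z)\<^sup>2) \<partial>lborel)"
      unfolding B R_def[symmetric] by (simp add: c_def mult_ac)
  qed
qed

end
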